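(* Let $m,n$ be positive integers and assume that $n$ is odd. Then $$\sum_{D\in \mathrm{D}(R_{m-1,n-1})} \sqrt{-1}^{\,h(D)}=\begin{cases}\left(\dfrac{m}{n}\right)&(m\equiv 1\pmod 2),\\[2mm] \left(\dfrac{m/2}{n}\right)&(m\equiv 0\pmod 2),\end{cases}$$ where the right hand side is the Jacobi symbol.
   Context: A board is a finite subset of $\mathbb{Z}\times\mathbb{Z}$; its elements are called squares. For non-negative integers $a,b$, $R_{a,b}=[a]\times[b]$ where $[k]=\{1,\dots,k\}$ (the rectangle of width $a$ and height $b$; it is empty if $a=0$ or $b=0$). A domino tiling of a board $X$ is a set $D$ of subsets of $X$ such that every element of $D$ consists of two adjacent squares of $X$ (squares at Euclidean distance $1$), and every square of $X$ lies in exactly one element of $D$. $\mathrm{D}(X)$ is the set of domino tilings of $X$ (the empty board has exactly one tiling, the empty one). A domino $\{(i,j),(i+1,j)\}$ is horizontal, and $\{(i,j),(i,j+1)\}$ is vertical. For a tiling $D$, $h(D)$ is the number of horizontal dominoes in $D$. *)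

theory Defs
  imports Complex_Main "HOL-Number_Theory.Number_Theory"
begin

type_synonym square = "int \<times> int"
type_synonym board = "square set"

definition rectangle :: "nat \<Rightarrow> nat \<Rightarrow> board" where
  "rectangle a b = {1..int a} \<times> {1..int b}"

text \<open>For integer points, Euclidean distance 1 means squared distance 1.\<close>

definition adjacent :: "square \<Rightarrow> square \<Rightarrow> bool" where
  "adjacent s t \<longleftrightarrow> (fst s - fst t)\<^sup>2 + (snd s - snd t)\<^sup>2 = 1"

definition domino_tiling :: "board \<Rightarrow> square set set \<Rightarrow> bool" where
  "domino_tiling X D \<longleftrightarrow>
     (\<forall>d\<in>D. \<exists>s\<in>X. \<exists>t\<in>X. adjacent s t \<and> d = {s, t}) \<and>
     (\<forall>s\<in>X. \<exists>!d. d \<in> D \<and> s \<in> d)"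

definition domino_tilings :: "board \<Rightarrow> square set set set" where
  "domino_tilings X = {D. domino_tiling X D}"

definition horizontal :: "square set \<Rightarrow> bool" where
  "horizontal d \<longleftrightarrow> (\<exists>i j. d = {(i, j), (i + 1, j)})"

definition num_horizontal :: "square set set \<Rightarrow> nat" where
  "num_horizontal D = card {d \<in> D. horizontal d}"

lemma finite_rectangle: "finite (rectangle a b)"
  by (simp add: rectangle_def)

lemma domino_tilings_subset: "domino_tilings X \<subseteq> Pow (Pow X)"
  by (fastforce simp: domino_tilings_def domino_tiling_def)

text \<open>Sums over the tilings of a finite board, and horizontal-domino counts in them,
  are therefore over finite sets.\<close>

lemma finite_domino_tilings: "finite X \<Longrightarrow> finite (domino_tilings X)"
  by (rule finite_subset[OF domino_tilings_subset]) simp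

lemma finite_domino_tiling: "finite X \<Longrightarrow> D \<in> domino_tilings X \<Longrightarrow> finite D"
  by (rule finite_subset[of D "Pow X"]) (use domino_tilings_subset[of X] in auto)

text \<open>The product of the Legendre symbols over the prime factors of n with multiplicity.
  This is the Jacobi symbol for odd positive n only: the library's \<open>Legendre a 2\<close>
  is not the Kronecker symbol.\<close>

definition Jacobi :: "int \<Rightarrow> nat \<Rightarrow> int" where
  "Jacobi a n = (\<Prod>p\<in>#prime_factorization n. Legendre a (int p))"

end

theory Submission
  imports Defs
begin

text \<open>
  Say that a square is matched forwards if its partner lies to the right or above, and backwards
  otherwise. If \<open>(x, y)\<close> is matched forwards and \<open>(x + 1, y + 1)\<close> backwards, then these two squares
  span a block tiled by two parallel dominoes; flipping it multiplies the weight by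
  \<open>\<i>\<^sup>2 = -1\<close> and does not change which squares of the colour of \<open>(x, y)\<close> are matched forwards.
  So flipping a block chosen from this information alone is a sign-reversing involution. Counting
  colours in two corner triangles of an \<open>N \<times> N\<close> square shows that such a block exists in the first
  \<open>N\<close> columns of a rectangle of height \<open>N\<close> unless all \<open>N\<close> squares of column \<open>N\<close> are matched with
  column \<open>N + 1\<close>. Hence adding \<open>N + 1\<close> columns multiplies the sum by a constant. Together with
  the transposition symmetry this constant is computed, and the sums obey the same Euclidean
  recurrences as the Jacobi symbol.
\<close>

section \<open>Domino tilings and their weighted sums\<close>

lemma adjacent_sym: "adjacent s t \<longleftrightarrow> adjacent t s"
  by (simp add: adjacent_def power2_commute)

lemma sum_squares_eq_1_iff:
  fixes a b :: int
  shows "a\<^sup>2 + b\<^sup>2 = 1 \<longleftrightarrow> (a = 0 \<and> \<bar>b\<bar> = 1) \<or> (\<bar>a\<bar> = 1 \<and> b = 0)"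
proof
  assume *: "a\<^sup>2 + b\<^sup>2 = 1"
  then have "a\<^sup>2 \<le> 1\<^sup>2" "b\<^sup>2 \<le> 1\<^sup>2"
    using zero_le_power2[of a] zero_le_power2[of b] by (smt (verit) one_power2)+
  then have "\<bar>a\<bar> \<le> 1" "\<bar>b\<bar> \<le> 1"
    by (metis abs_le_square_iff abs_one)+
  then have "a \<in> {-1,0,1}" "b \<in> {-1,0,1}" by auto
  with * show "(a = 0 \<and> \<bar>b\<bar> = 1) \<or> (\<bar>a\<bar> = 1 \<and> b = 0)" by auto
qed (auto simp: abs_if split: if_splits)

lemma adjacent_iff:
  "adjacent (x, y) t \<longleftrightarrow> t \<in> {(x+1, y), (x-1, y), (x, y+1), (x, y-1)}"
  by (cases t) (auto simp: adjacent_def sum_squares_eq_1_iff)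

lemma adjacent_irrefl [simp]: "\<not> adjacent s s"
  by (simp add: adjacent_def)

lemma tiling_dominoD:
  "domino_tiling X D \<Longrightarrow> d \<in> D \<Longrightarrow> \<exists>s\<in>X. \<exists>t\<in>X. adjacent s t \<and> d = {s, t}"
  unfolding domino_tiling_def by (rule bspec[OF conjunct1])

lemma tiling_domino:
  assumes "domino_tiling X D" "d \<in> D"
  obtains s t where "s \<in> X" "t \<in> X" "adjacent s t" "d = {s, t}"
  using tiling_dominoD[OF assms] by blast

lemma tiling_subset: "domino_tiling X D \<Longrightarrow> d \<in> D \<Longrightarrow> d \<subseteq> X"
  by (auto elim: tiling_domino)

lemma tiling_pair:
  assumes "domino_tiling X D" "{s, t} \<in> D"
  shows "s \<in> X" "t \<in> X" "adjacent s t"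
  using tiling_domino[OF assms] by (metis adjacent_sym doubleton_eq_iff)+

lemma tiling_unique:
  assumes "domino_tiling X D" "d \<in> D" "e \<in> D" "s \<in> d" "s \<in> e"
  shows "d = e"
  using assms tiling_subset[OF assms(1,2)] unfolding domino_tiling_def by blast

lemma tiling_unique_pair:
  assumes "domino_tiling X D" "{s, t} \<in> D" "{s, u} \<in> D"
  shows "t = u"
  using tiling_unique[OF assms, of s] by (auto simp: doubleton_eq_iff)

lemma tiling_partner:
  assumes "domino_tiling X D" "s \<in> X"
  obtains t where "{s, t} \<in> D" "t \<in> X" "adjacent s t"
proof -
  obtain d where d: "d \<in> D" "s \<in> d"
    using assms unfolding domino_tiling_def by blast
  with tiling_domino[OF assms(1) d(1)] obtain t where "d = {s, t}"
    by blast
  with d tiling_pair[OF assms(1), of s t] that show ?thesis by blast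
qed

lemma tilingI:
  assumes "\<And>d. d \<in> D \<Longrightarrow> \<exists>s\<in>X. \<exists>t\<in>X. adjacent s t \<and> d = {s, t}"
    and "\<And>s. s \<in> X \<Longrightarrow> \<exists>d\<in>D. s \<in> d"
    and "\<And>d e s. d \<in> D \<Longrightarrow> e \<in> D \<Longrightarrow> s \<in> d \<Longrightarrow> s \<in> e \<Longrightarrow> d = e"
  shows "domino_tiling X D"
  unfolding domino_tiling_def using assms by blast

lemma tiling_covers: "domino_tiling X D \<Longrightarrow> s \<in> X \<Longrightarrow> \<exists>d\<in>D. s \<in> d"
  unfolding domino_tiling_def by blast

section \<open>Gluing, cutting and restricting tilings\<close>

lemma tiling_Un:
  assumes "domino_tiling A D" "domino_tiling B E" "A \<inter> B = {}"
  shows "domino_tiling (A \<union> B) (D \<union> E)"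
proof (rule tilingI)
  fix d e s assume *: "d \<in> D \<union> E" "e \<in> D \<union> E" "s \<in> d" "s \<in> e"
  have "(d \<in> D \<and> e \<in> D) \<or> (d \<in> E \<and> e \<in> E)"
    using * assms(3) tiling_subset[OF assms(1)] tiling_subset[OF assms(2)] by blast
  then show "d = e"
    using * tiling_unique[OF assms(1)] tiling_unique[OF assms(2)] by blast
next
  fix d assume "d \<in> D \<union> E"
  then show "\<exists>s\<in>A \<union> B. \<exists>t\<in>A \<union> B. adjacent s t \<and> d = {s, t}"
    using tiling_dominoD[OF assms(1), of d] tiling_dominoD[OF assms(2), of d]
    by (elim UnE) blast+
next
  fix s assume "s \<in> A \<union> B"
  then show "\<exists>d\<in>D \<union> E. s \<in> d"
    using tiling_covers[OF assms(1), of s] tiling_covers[OF assms(2), of s] by blast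
qed

text \<open>Each square of \<open>Y\<close> already lies in a domino of \<open>E\<close>, so by
  uniqueness a domino of \<open>D - E\<close> cannot meet \<open>Y\<close>.\<close>

lemma tiling_Diff:
  assumes "domino_tiling X D" "domino_tiling Y E" "E \<subseteq> D"
  shows "domino_tiling (X - Y) (D - E)"
proof (rule tilingI)
  fix d assume d: "d \<in> D - E"
  have disj: "d \<inter> Y = {}"
  proof (rule ccontr)
    assume "d \<inter> Y \<noteq> {}"
    then obtain s e where "s \<in> d" "e \<in> E" "s \<in> e"
      using tiling_covers[OF assms(2)] by blast
    then show False using d assms(3) tiling_unique[OF assms(1)] by blast
  qed
  obtain s t where st: "s \<in> X" "t \<in> X" "adjacent s t" "d = {s, t}"
    using d by (auto intro: tiling_domino[OF assms(1)])
  then show "\<exists>s\<in>X - Y. \<exists>t\<in>X - Y. adjacent s t \<and> d = {s, t}"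
    using disj by blast
next
  fix s assume "s \<in> X - Y"
  then show "\<exists>d\<in>D - E. s \<in> d"
    using tiling_covers[OF assms(1)] tiling_subset[OF assms(2)] by blast
next
  fix d e s assume "d \<in> D - E" "e \<in> D - E" "s \<in> d" "s \<in> e"
  then show "d = e" by (intro tiling_unique[OF assms(1), of d e s]) simp_all
qed

lemma tiling_restrict:
  assumes "domino_tiling X D" "A \<subseteq> X"
    and "\<And>s t. s \<in> A \<Longrightarrow> t \<in> X - A \<Longrightarrow> \<not> adjacent s t"
  shows "domino_tiling A {d \<in> D. d \<subseteq> A}"
proof (rule tilingI)
  fix d assume d: "d \<in> {d \<in> D. d \<subseteq> A}"
  then obtain s t where "adjacent s t" "d = {s, t}"
    using tiling_dominoD[OF assms(1), of d] by blast
  with d show "\<exists>s\<in>A. \<exists>t\<in>A. adjacent s t \<and> d = {s, t}" by blast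
next
  fix s assume s: "s \<in> A"
  then obtain t where t: "{s, t} \<in> D" "t \<in> X" "adjacent s t"
    using tiling_partner[OF assms(1)] assms(2) by (metis subsetD)
  then have "t \<in> A" using s assms(3) by blast
  with s t show "\<exists>d\<in>{d \<in> D. d \<subseteq> A}. s \<in> d" by blast
next
  fix d e s assume "d \<in> {d \<in> D. d \<subseteq> A}" "e \<in> {d \<in> D. d \<subseteq> A}" "s \<in> d" "s \<in> e"
  then show "d = e" by (intro tiling_unique[OF assms(1), of d e s]) simp_all
qed

text \<open>Fixes the total number of dominoes, so that transposition can express vertical counts
  through horizontal ones.\<close>

lemma card_tiling:
  assumes "finite X" "domino_tiling X D"
  shows "2 * card D = card X"
proof -
  have U: "\<Union>D = X"
    using tiling_subset[OF assms(2)] tiling_covers[OF assms(2)] by blast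
  have "2 * card D = card (\<Union>D)"
  proof (rule card_partition)
    show "finite D"
      using finite_domino_tiling[OF assms(1)] assms(2) by (simp add: domino_tilings_def)
    show "finite (\<Union>D)" using U assms(1) by simp
    show "card d = 2" if "d \<in> D" for d
      using tiling_domino[OF assms(2) that]
      by (metis adjacent_irrefl card_2_iff)
    show "d \<inter> e = {}" if "d \<in> D" "e \<in> D" "d \<noteq> e" for d e
      using tiling_unique[OF assms(2) that(1,2)] that(3) by blast
  qed
  with U show ?thesis by simp
qed

section \<open>Weighted sums and their factorization\<close>

definition tiling_sum :: "board \<Rightarrow> complex" where
  "tiling_sum X = (\<Sum>D\<in>domino_tilings X. \<i> ^ num_horizontal D)"

lemma num_horizontal_Un:
  assumes "finite D" "finite E" "D \<inter> E = {}"
  shows "num_horizontal (D \<union> E) = num_horizontal D + num_horizontal E"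
proof -
  have "{d \<in> D \<union> E. horizontal d} = {d \<in> D. horizontal d} \<union> {d \<in> E. horizontal d}"
    by blast
  then show ?thesis
    using assms unfolding num_horizontal_def by (subst card_Un_disjoint[symmetric]) auto
qed

lemma tilings_disjoint:
  assumes "domino_tiling A D" "domino_tiling B E" "A \<inter> B = {}"
  shows "D \<inter> E = {}"
proof (rule ccontr)
  assume "D \<inter> E \<noteq> {}"
  then obtain d where d: "d \<in> D" "d \<in> E" by blast
  then obtain s where "s \<in> d" using tiling_domino[OF assms(1)] by blast
  then show False
    using d tiling_subset[OF assms(1)] tiling_subset[OF assms(2)] assms(3) by blast
qed

text \<open>Removing \<open>E\<close> is inverse to gluing it back on \<open>Y\<close>, and weights
  multiply because horizontal counts add.\<close>

lemma tiling_sum_containing: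
  assumes "finite X" "Y \<subseteq> X" "domino_tiling Y E"
  shows "(\<Sum>D | domino_tiling X D \<and> E \<subseteq> D. \<i> ^ num_horizontal D)
           = \<i> ^ num_horizontal E * tiling_sum (X - Y)"
proof -
  have fin: "finite D" if "domino_tiling Z D" "Z \<subseteq> X" for D Z
    using finite_domino_tiling[of Z D] that assms(1) finite_subset
    by (auto simp: domino_tilings_def)
  have "bij_betw (\<lambda>D. D \<union> E) (domino_tilings (X - Y)) {D. domino_tiling X D \<and> E \<subseteq> D}"
  proof (rule bij_betw_byWitness[where f' = "\<lambda>D. D - E"])
    show "\<forall>D\<in>domino_tilings (X - Y). D \<union> E - E = D"
      using tilings_disjoint[OF _ assms(3), of "X - Y"]
      by (auto simp: domino_tilings_def)
    show "(\<lambda>D. D \<union> E) ` domino_tilings (X - Y) \<subseteq> {D. domino_tiling X D \<and> E \<subseteq> D}"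
      using tiling_Un[OF _ assms(3), of "X - Y"] assms(2)
      by (auto simp: domino_tilings_def Un_absorb2)
    show "(\<lambda>D. D - E) ` {D. domino_tiling X D \<and> E \<subseteq> D} \<subseteq> domino_tilings (X - Y)"
      using tiling_Diff[OF _ assms(3)] by (auto simp: domino_tilings_def)
  qed auto
  then have "(\<Sum>D | domino_tiling X D \<and> E \<subseteq> D. \<i> ^ num_horizontal D)
      = (\<Sum>D\<in>domino_tilings (X - Y). \<i> ^ num_horizontal (D \<union> E))"
    by (rule sum.reindex_bij_betw[symmetric])
  also have "\<dots> = (\<Sum>D\<in>domino_tilings (X - Y). \<i> ^ num_horizontal E * \<i> ^ num_horizontal D)"
  proof (rule sum.cong)
    fix D assume "D \<in> domino_tilings (X - Y)"
    then have D: "domino_tiling (X - Y) D" by (simp add: domino_tilings_def)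
    show "\<i> ^ num_horizontal (D \<union> E) = \<i> ^ num_horizontal E * \<i> ^ num_horizontal D"
      using num_horizontal_Un[OF fin[OF D] fin[OF assms(3,2)] tilings_disjoint[OF D assms(3)]]
      by (simp add: power_add Diff_disjoint Int_commute)
  qed simp
  finally show ?thesis by (simp add: tiling_sum_def sum_distrib_left)
qed

text \<open>Without adjacency between the parts every domino lies inside one of them, so a tiling is
  a pair of independent tilings and the double sum factors.\<close>

lemma tiling_sum_Un:
  assumes "finite A" "finite B" "A \<inter> B = {}"
    and nadj: "\<And>s t. s \<in> A \<Longrightarrow> t \<in> B \<Longrightarrow> \<not> adjacent s t"
  shows "tiling_sum (A \<union> B) = tiling_sum A * tiling_sum B"
proof -
  let ?f = "\<lambda>(D, E). D \<union> (E :: square set set)"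
  have "bij_betw ?f (domino_tilings A \<times> domino_tilings B) (domino_tilings (A \<union> B))"
  proof (rule bij_betw_byWitness[where f' = "\<lambda>D. ({d \<in> D. d \<subseteq> A}, {d \<in> D. d \<subseteq> B})"])
    have "{d \<in> D \<union> E. d \<subseteq> A} = D" "{d \<in> D \<union> E. d \<subseteq> B} = E"
      if "domino_tiling A D" "domino_tiling B E" for D E
    proof -
      have ne: "\<not> (d \<subseteq> A \<and> d \<subseteq> B)" if "domino_tiling X F" "d \<in> F" for X F d
        using tiling_dominoD[OF that] assms(3) by blast
      show "{d \<in> D \<union> E. d \<subseteq> A} = D" "{d \<in> D \<union> E. d \<subseteq> B} = E"
        using ne[OF that(1)] ne[OF that(2)] tiling_subset[OF that(1)] tiling_subset[OF that(2)]
        by blast+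
    qed
    then show "\<forall>p\<in>domino_tilings A \<times> domino_tilings B.
        (\<lambda>D. ({d \<in> D. d \<subseteq> A}, {d \<in> D. d \<subseteq> B})) (?f p) = p"
      by (auto simp: domino_tilings_def)
    have "{d \<in> D. d \<subseteq> A} \<union> {d \<in> D. d \<subseteq> B} = D" if D: "domino_tiling (A \<union> B) D" for D
    proof -
      have "d \<subseteq> A \<or> d \<subseteq> B" if "d \<in> D" for d
        using tiling_dominoD[OF D that] nadj adjacent_sym by blast
      then show ?thesis by blast
    qed
    then show "\<forall>D\<in>domino_tilings (A \<union> B). ?f ({d \<in> D. d \<subseteq> A}, {d \<in> D. d \<subseteq> B}) = D"
      by (simp add: domino_tilings_def)
    show "?f ` (domino_tilings A \<times> domino_tilings B) \<subseteq> domino_tilings (A \<union> B)"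
      using tiling_Un[OF _ _ assms(3)] by (auto simp: domino_tilings_def)
    have nadj': "\<not> adjacent s t" if "s \<in> B" "t \<in> A" for s t
      using nadj[OF that(2,1)] adjacent_sym by blast
    have "domino_tiling A {d \<in> D. d \<subseteq> A}" "domino_tiling B {d \<in> D. d \<subseteq> B}"
      if D: "domino_tiling (A \<union> B) D" for D
      using nadj nadj' by (blast intro: tiling_restrict[OF D])+
    then show "(\<lambda>D. ({d \<in> D. d \<subseteq> A}, {d \<in> D. d \<subseteq> B})) ` domino_tilings (A \<union> B)
        \<subseteq> domino_tilings A \<times> domino_tilings B"
      by (auto simp: domino_tilings_def)
  qed
  then have "tiling_sum (A \<union> B)
      = (\<Sum>p\<in>domino_tilings A \<times> domino_tilings B. \<i> ^ num_horizontal (?f p))"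
    unfolding tiling_sum_def by (rule sum.reindex_bij_betw[symmetric])
  also have "\<dots> = (\<Sum>(D, E)\<in>domino_tilings A \<times> domino_tilings B.
      \<i> ^ num_horizontal D * \<i> ^ num_horizontal E)"
  proof (rule sum.cong)
    fix p assume p: "p \<in> domino_tilings A \<times> domino_tilings B"
    then obtain D E where p: "p = (D, E)" "D \<in> domino_tilings A" "E \<in> domino_tilings B"
      by auto
    have "D \<inter> E = {}"
      using p tilings_disjoint[OF _ _ assms(3)] by (simp add: domino_tilings_def)
    then have "num_horizontal (D \<union> E) = num_horizontal D + num_horizontal E"
      using p finite_domino_tiling assms by (intro num_horizontal_Un) auto
    then show "\<i> ^ num_horizontal (?f p) =
        (case p of (D, E) \<Rightarrow> \<i> ^ num_horizontal D * \<i> ^ num_horizontal E)"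
      by (simp add: p power_add)
  qed simp
  finally show ?thesis
    by (simp add: tiling_sum_def sum_product sum.cartesian_product)
qed

section \<open>Translation and transposition\<close>

lemma tiling_image:
  assumes "inj f" "\<And>s t. adjacent (f s) (f t) = adjacent s t" "domino_tiling X D"
  shows "domino_tiling (f ` X) ((`) f ` D)"
proof (rule tilingI)
  fix d assume "d \<in> (`) f ` D"
  then obtain d' where "d' \<in> D" "d = f ` d'" by blast
  moreover from this obtain s t where "s \<in> X" "t \<in> X" "adjacent s t" "d' = {s, t}"
    using tiling_dominoD[OF assms(3), of d'] by blast
  ultimately show "\<exists>s\<in>f ` X. \<exists>t\<in>f ` X. adjacent s t \<and> d = {s, t}"
    by (intro bexI[of _ "f s"] bexI[of _ "f t"]) (simp_all add: assms(2))
next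
  fix s assume "s \<in> f ` X"
  then obtain t where "t \<in> X" "s = f t" by blast
  moreover from this obtain d where "d \<in> D" "t \<in> d"
    using tiling_covers[OF assms(3)] by blast
  ultimately show "\<exists>d\<in>(`) f ` D. s \<in> d" by blast
next
  fix d e s assume "d \<in> (`) f ` D" "e \<in> (`) f ` D" "s \<in> d" "s \<in> e"
  then obtain d' e' a b where *: "d' \<in> D" "e' \<in> D" "d = f ` d'" "e = f ` e'"
    "a \<in> d'" "b \<in> e'" "s = f a" "s = f b" by blast
  then have "a = b" using assms(1) by (simp add: inj_eq)
  with * have "d' = e'" using tiling_unique[OF assms(3), of d' e' a] by simp
  with * show "d = e" by simp
qed

lemma bij_betw_tilings_image:
  assumes "\<And>s. g (f s) = s" "\<And>s. f (g s) = s" "\<And>s t. adjacent (f s) (f t) = adjacent s t"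
  shows "bij_betw ((`) ((`) f)) (domino_tilings X) (domino_tilings (f ` X))"
proof (rule bij_betw_byWitness[where f' = "(`) ((`) g)"])
  have "inj f" "inj g" by (metis assms(1,2) injI)+
  have adj: "adjacent (g s) (g t) = adjacent s t" for s t
    by (metis assms(2,3))
  show "(`) ((`) f) ` domino_tilings X \<subseteq> domino_tilings (f ` X)"
    using tiling_image[OF \<open>inj f\<close> assms(3)] by (auto simp: domino_tilings_def)
  show "(`) ((`) g) ` domino_tilings (f ` X) \<subseteq> domino_tilings X"
    using tiling_image[OF \<open>inj g\<close> adj, of "f ` X"]
    by (auto simp: domino_tilings_def image_image assms(1))
qed (simp_all add: image_image assms(1,2))

lemma horizontal_doubleton_iff:
  "horizontal {(x, y), (x', y')} \<longleftrightarrow> y = y' \<and> (x' = x + 1 \<or> x = x' + 1)"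
  by (auto simp: horizontal_def doubleton_eq_iff)

lemma tiling_sum_translate:
  "tiling_sum ((\<lambda>(x, y). (x + a, y)) ` X) = tiling_sum X"
proof -
  let ?f = "\<lambda>(x, y). (x + a :: int, y :: int)"
  have bij: "bij_betw ((`) ((`) ?f)) (domino_tilings X) (domino_tilings (?f ` X))"
    by (rule bij_betw_tilings_image[where g = "\<lambda>(x, y). (x - a, y)"])
      (auto simp: adjacent_def)
  have inj: "inj ((`) ?f)" by (intro inj_on_image) (auto simp: inj_on_def)
  have hor: "horizontal (?f ` d) \<longleftrightarrow> horizontal d" if "domino_tiling X D" "d \<in> D" for D d
    using tiling_dominoD[OF that] by (auto simp: horizontal_doubleton_iff)
  have "num_horizontal ((`) ?f ` D) = num_horizontal D"
    if "D \<in> domino_tilings X" for D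
  proof -
    have D: "domino_tiling X D" using that by (simp add: domino_tilings_def)
    have "{d \<in> (`) ?f ` D. horizontal d} = (`) ?f ` {d \<in> D. horizontal d}"
      using hor[OF D] by blast
    then show ?thesis
      unfolding num_horizontal_def using inj by (simp add: card_image inj_on_subset)
  qed
  then show ?thesis
    unfolding tiling_sum_def by (subst sum.reindex_bij_betw[OF bij, symmetric]) simp
qed

lemma rectangle_transpose: "prod.swap ` rectangle a b = rectangle b a"
  by (auto simp: rectangle_def image_def)

lemma horizontal_swap:
  assumes "domino_tiling X D" "d \<in> D"
  shows "horizontal (prod.swap ` d) \<longleftrightarrow> \<not> horizontal d"
proof -
  obtain x y t where d: "adjacent (x, y) t" "d = {(x, y), t}"
    using tiling_dominoD[OF assms] by (metis surj_pair)
  then show ?thesis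
    by (auto simp: adjacent_iff horizontal_doubleton_iff)
qed

text \<open>The coordinate swap turns the \<open>a * b div 2 - h\<close> vertical dominoes into
  horizontal ones, and \<open>\<i> ^ h\<close> has inverse \<open>cnj (\<i> ^ h)\<close>. If
  \<open>a * b\<close> is odd, no tiling exists and both sides are zero.\<close>

lemma tiling_sum_transpose:
  "tiling_sum (rectangle b a) = \<i> ^ (a * b div 2) * cnj (tiling_sum (rectangle a b))"
proof -
  let ?X = "rectangle a b"
  have bij: "bij_betw ((`) ((`) prod.swap)) (domino_tilings ?X) (domino_tilings (rectangle b a))"
    using bij_betw_tilings_image[where f = prod.swap and g = prod.swap and X = ?X]
    by (simp add: rectangle_transpose adjacent_def add.commute)
  have "\<i> ^ num_horizontal ((`) prod.swap ` D) = \<i> ^ (a * b div 2) * cnj (\<i> ^ num_horizontal D)"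
    if "D \<in> domino_tilings ?X" for D
  proof -
    have D: "domino_tiling ?X D" using that by (simp add: domino_tilings_def)
    have fin: "finite D" by (rule finite_domino_tiling[OF finite_rectangle that])
    have card: "card D = a * b div 2"
      using card_tiling[OF finite_rectangle D] by (simp add: rectangle_def)
    have "{d \<in> (`) prod.swap ` D. horizontal d} = (`) prod.swap ` {d \<in> D. \<not> horizontal d}"
      using horizontal_swap[OF D] by blast
    moreover have "inj ((`) (prod.swap :: square \<Rightarrow> _))" by (intro inj_on_image) simp
    ultimately have "num_horizontal ((`) prod.swap ` D) = card {d \<in> D. \<not> horizontal d}"
      unfolding num_horizontal_def by (simp add: card_image inj_on_subset)
    moreover have "card D = card {d \<in> D. horizontal d} + card {d \<in> D. \<not> horizontal d}"
      using fin by (subst card_Un_disjoint[symmetric]) (auto intro: arg_cong[where f = card])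
    ultimately have "num_horizontal ((`) prod.swap ` D) + num_horizontal D = a * b div 2"
      using card by (simp add: num_horizontal_def)
    then have "\<i> ^ (a * b div 2) = \<i> ^ num_horizontal ((`) prod.swap ` D) * \<i> ^ num_horizontal D"
      by (metis power_add)
    then show ?thesis by (simp flip: power_mult_distrib)
  qed
  then show ?thesis
    unfolding tiling_sum_def cnj_sum sum_distrib_left
    by (subst sum.reindex_bij_betw[OF bij, symmetric]) simp
qed

section \<open>Flipping two-by-two blocks\<close>

definition fwd :: "square set set \<Rightarrow> int \<Rightarrow> int \<Rightarrow> bool" where
  "fwd D x y \<longleftrightarrow> {(x, y), (x + 1, y)} \<in> D \<or> {(x, y), (x, y + 1)} \<in> D"

definition bwd :: "square set set \<Rightarrow> int \<Rightarrow> int \<Rightarrow> bool" where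
  "bwd D x y \<longleftrightarrow> {(x, y), (x - 1, y)} \<in> D \<or> {(x, y), (x, y - 1)} \<in> D"

definition horizontal_pair :: "int \<Rightarrow> int \<Rightarrow> square set set" where
  "horizontal_pair x y = {{(x, y), (x + 1, y)}, {(x, y + 1), (x + 1, y + 1)}}"

definition vertical_pair :: "int \<Rightarrow> int \<Rightarrow> square set set" where
  "vertical_pair x y = {{(x, y), (x, y + 1)}, {(x + 1, y), (x + 1, y + 1)}}"

text \<open>The symmetric difference with all four dominoes trades whichever parallel pair is
  present for the other. It is an involution on arbitrary sets of dominoes, before any tiling is
  considered.\<close>

definition flip :: "int \<Rightarrow> int \<Rightarrow> square set set \<Rightarrow> square set set" where
  "flip x y D = sym_diff D (horizontal_pair x y \<union> vertical_pair x y)"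

lemma flip_flip [simp]: "flip x y (flip x y D) = D"
  by (auto simp: flip_def)

lemma fwd_or_bwd:
  assumes "domino_tiling X D" "(x, y) \<in> X"
  shows "fwd D x y \<or> bwd D x y"
proof -
  obtain t where "{(x, y), t} \<in> D" "adjacent (x, y) t"
    using tiling_partner[OF assms] by blast
  then show ?thesis by (auto simp: adjacent_iff fwd_def bwd_def)
qed

lemma tilings_square:
  fixes x y :: int
  defines "B \<equiv> {x, x + 1} \<times> {y, y + 1}"
  shows "domino_tiling B (horizontal_pair x y)" "domino_tiling B (vertical_pair x y)"
proof -
  show "domino_tiling B (horizontal_pair x y)"
  proof (rule tilingI)
    show "\<exists>s\<in>B. \<exists>t\<in>B. adjacent s t \<and> d = {s, t}" if "d \<in> horizontal_pair x y" for d
    proof -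
      obtain b where "b \<in> {y, y + 1}" "d = {(x, b), (x + 1, b)}"
        using \<open>d \<in> horizontal_pair x y\<close> by (auto simp: horizontal_pair_def)
      then show ?thesis
        by (intro bexI[of _ "(x, b)"] bexI[of _ "(x + 1, b)"]) (auto simp: B_def adjacent_iff)
    qed
  qed (auto simp: B_def horizontal_pair_def)
  show "domino_tiling B (vertical_pair x y)"
  proof (rule tilingI)
    show "\<exists>s\<in>B. \<exists>t\<in>B. adjacent s t \<and> d = {s, t}" if "d \<in> vertical_pair x y" for d
    proof -
      obtain a where "a \<in> {x, x + 1}" "d = {(a, y), (a, y + 1)}"
        using \<open>d \<in> vertical_pair x y\<close> by (auto simp: vertical_pair_def)
      then show ?thesis
        by (intro bexI[of _ "(a, y)"] bexI[of _ "(a, y + 1)"]) (auto simp: B_def adjacent_iff)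
    qed
  qed (auto simp: B_def vertical_pair_def)
qed

lemma num_horizontal_pair:
  "num_horizontal (horizontal_pair x y) = 2" "num_horizontal (vertical_pair x y) = 0"
proof -
  have "{d \<in> horizontal_pair x y. horizontal d} = horizontal_pair x y"
    by (auto simp: horizontal_pair_def horizontal_doubleton_iff)
  moreover have "card (horizontal_pair x y) = 2"
    by (simp add: horizontal_pair_def doubleton_eq_iff)
  ultimately show "num_horizontal (horizontal_pair x y) = 2"
    by (simp add: num_horizontal_def)
  have "{d \<in> vertical_pair x y. horizontal d} = {}"
    by (auto simp: vertical_pair_def horizontal_doubleton_iff)
  then show "num_horizontal (vertical_pair x y) = 0"
    unfolding num_horizontal_def by (simp only: card.empty)
qed

text \<open>If the dominoes of \<open>(x, y)\<close> and \<open>(x + 1, y + 1)\<close> were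
  perpendicular, they would share one of the other two squares of the block.\<close>

lemma flippable_cases:
  assumes "domino_tiling X D" "fwd D x y" "bwd D (x + 1) (y + 1)"
  shows "(horizontal_pair x y \<subseteq> D \<and> vertical_pair x y \<inter> D = {}) \<or>
         (vertical_pair x y \<subseteq> D \<and> horizontal_pair x y \<inter> D = {})"
proof -
  have u: "d = e" if "d \<in> D" "e \<in> D" "s \<in> d" "s \<in> e" for d e s
    by (rule tiling_unique[OF assms(1) that])
  let ?a = "{(x, y), (x + 1, y)}" and ?b = "{(x, y + 1), (x + 1, y + 1)}"
  let ?c = "{(x, y), (x, y + 1)}" and ?d = "{(x + 1, y), (x + 1, y + 1)}"
  have "?a \<in> D \<or> ?c \<in> D" using assms(2) by (simp add: fwd_def)
  moreover have "?b \<in> D \<or> ?d \<in> D" using assms(3) by (simp add: bwd_def insert_commute)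
  moreover have "\<not> (?a \<in> D \<and> ?c \<in> D)" using u[of ?a ?c "(x, y)"] by (auto simp: doubleton_eq_iff)
  moreover have "\<not> (?a \<in> D \<and> ?d \<in> D)" using u[of ?a ?d "(x + 1, y)"] by (auto simp: doubleton_eq_iff)
  moreover have "\<not> (?b \<in> D \<and> ?c \<in> D)" using u[of ?b ?c "(x, y + 1)"] by (auto simp: doubleton_eq_iff)
  moreover have "\<not> (?b \<in> D \<and> ?d \<in> D)" using u[of ?b ?d "(x + 1, y + 1)"] by (auto simp: doubleton_eq_iff)
  ultimately show ?thesis unfolding horizontal_pair_def vertical_pair_def by auto
qed

text \<open>A part of \<open>D\<close> that tiles \<open>B\<close> may be replaced by any other
  tiling of \<open>B\<close>; the additive form of the count avoids truncated subtraction.\<close>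

lemma exchange_pair:
  assumes "finite X" "domino_tiling X D" "domino_tiling B E" "domino_tiling B E'" "E \<subseteq> D" "B \<subseteq> X"
  shows "domino_tiling X ((D - E) \<union> E')"
    and "num_horizontal ((D - E) \<union> E') + num_horizontal E = num_horizontal D + num_horizontal E'"
proof -
  have fin: "finite F" if "domino_tiling Y F" "Y \<subseteq> X" for Y F
    using finite_domino_tiling[of Y F] that finite_subset[OF that(2) assms(1)]
    by (simp add: domino_tilings_def)
  have T: "domino_tiling (X - B) (D - E)"
    by (rule tiling_Diff[OF assms(2,3,5)])
  have *: "(X - B) \<inter> B = {}" "X - B \<union> B = X" using assms(6) by auto
  show "domino_tiling X ((D - E) \<union> E')"
    using tiling_Un[OF T assms(4) *(1)] *(2) by simp
  have "num_horizontal ((D - E) \<union> E') = num_horizontal (D - E) + num_horizontal E'"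
    using fin[OF T] fin[OF assms(4,6)] tilings_disjoint[OF T assms(4) *(1)]
    by (intro num_horizontal_Un) auto
  moreover have "num_horizontal ((D - E) \<union> E) = num_horizontal (D - E) + num_horizontal E"
    using fin[OF T] fin[OF assms(3,6)] by (intro num_horizontal_Un) auto
  moreover have "(D - E) \<union> E = D" using assms(5) by auto
  ultimately show "num_horizontal ((D - E) \<union> E') + num_horizontal E
      = num_horizontal D + num_horizontal E'" by simp
qed

text \<open>The exchange changes the horizontal count by two, up or down, and the weight changes
  sign either way.\<close>

lemma tiling_flip:
  assumes "finite X" "domino_tiling X D" "fwd D x y" "bwd D (x + 1) (y + 1)"
  shows "domino_tiling X (flip x y D)"
    and "\<i> ^ num_horizontal (flip x y D) = - (\<i> ^ num_horizontal D)"
proof -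
  define H V where "H = horizontal_pair x y" and "V = vertical_pair x y"
  define B where "B = {x, x + 1} \<times> {y, y + 1}"
  have T: "domino_tiling B H" "domino_tiling B V"
    unfolding B_def H_def V_def by (rule tilings_square)+
  have n: "num_horizontal H = 2" "num_horizontal V = 0"
    by (simp_all add: H_def V_def num_horizontal_pair)
  have sub: "B \<subseteq> X" if "domino_tiling B E" "E \<subseteq> D" for E
    using tiling_covers[OF that(1)] tiling_subset[OF assms(2)] that(2) by blast
  consider "H \<subseteq> D" "V \<inter> D = {}" | "V \<subseteq> D" "H \<inter> D = {}"
    using flippable_cases[OF assms(2-4)] unfolding H_def V_def by blast
  then have "domino_tiling X (flip x y D) \<and>
    \<i> ^ num_horizontal (flip x y D) = - (\<i> ^ num_horizontal D)"
  proof cases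
    case 1
    have "flip x y D = (D - H) \<union> V" using 1 unfolding flip_def H_def V_def by blast
    moreover note ex = exchange_pair[OF assms(1,2) T 1(1) sub[OF T(1) 1(1)]]
    moreover have "\<i> ^ num_horizontal D = \<i> ^ (num_horizontal ((D - H) \<union> V) + 2)"
      using ex(2) n by simp
    ultimately show ?thesis by (simp add: power_add)
  next
    case 2
    have "flip x y D = (D - V) \<union> H" using 2 unfolding flip_def H_def V_def by blast
    with exchange_pair[OF assms(1,2) T(2,1) 2(1) sub[OF T(2) 2(1)]] n show ?thesis
      by (simp add: power_add)
  qed
  then show "domino_tiling X (flip x y D)"
    "\<i> ^ num_horizontal (flip x y D) = - (\<i> ^ num_horizontal D)" by blast+
qed

text \<open>Of the squares from which a domino of the block leads forwards, only
  \<open>(x, y)\<close> has the given colour, and it is matched forwards before and after the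
  flip.\<close>

lemma fwd_flip:
  assumes "domino_tiling X D" "fwd D x y" "bwd D (x + 1) (y + 1)" "even (x' + y' + x + y)"
  shows "fwd (flip x y D) x' y' = fwd D x' y'"
proof (cases "(x', y') = (x, y)")
  case True
  then show ?thesis
    using flippable_cases[OF assms(1-3)]
    by (auto simp: fwd_def flip_def horizontal_pair_def vertical_pair_def)
next
  case False
  have *: "y' \<noteq> y + 1 \<or> x' \<noteq> x" "x' \<noteq> x + 1 \<or> y' \<noteq> y" using assms(4) by auto
  have "{(x', y'), (x' + 1, y')} \<notin> horizontal_pair x y \<union> vertical_pair x y"
    "{(x', y'), (x', y' + 1)} \<notin> horizontal_pair x y \<union> vertical_pair x y"
    using False * by (auto simp: horizontal_pair_def vertical_pair_def doubleton_eq_iff)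
  then show ?thesis by (auto simp: fwd_def flip_def)
qed

text \<open>Mirror image of \<open>fwd_flip\<close>: the square of this colour to watch is
  \<open>(x + 1, y + 1)\<close>, matched backwards before and after.\<close>

lemma bwd_flip:
  assumes "domino_tiling X D" "fwd D x y" "bwd D (x + 1) (y + 1)" "even (x' + y' + x + y)"
  shows "bwd (flip x y D) x' y' = bwd D x' y'"
proof (cases "(x', y') = (x + 1, y + 1)")
  case True
  then show ?thesis
    using flippable_cases[OF assms(1-3)]
    by (auto simp: bwd_def flip_def horizontal_pair_def vertical_pair_def insert_commute)
next
  case False
  have *: "y' \<noteq> y + 1 \<or> x' \<noteq> x" "x' \<noteq> x + 1 \<or> y' \<noteq> y" using assms(4) by auto
  have "{(x', y'), (x' - 1, y')} \<notin> horizontal_pair x y \<union> vertical_pair x y"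
    "{(x', y'), (x', y' - 1)} \<notin> horizontal_pair x y \<union> vertical_pair x y"
    using False * by (auto simp: horizontal_pair_def vertical_pair_def doubleton_eq_iff)
  then show ?thesis by (auto simp: bwd_def flip_def)
qed

section \<open>Cancellation by a sign-reversing involution\<close>

lemma sum_sign_reversing_involution:
  fixes f :: "'a \<Rightarrow> complex"
  assumes "\<And>a. a \<in> A \<Longrightarrow> \<phi> a \<in> A" "\<And>a. a \<in> A \<Longrightarrow> \<phi> (\<phi> a) = a"
    and "\<And>a. a \<in> A \<Longrightarrow> f (\<phi> a) = - f a"
  shows "sum f A = 0"
proof -
  have "bij_betw \<phi> A A"
    by (rule bij_betw_byWitness[where f' = \<phi>]) (use assms in auto)
  then have "sum f A = (\<Sum>a\<in>A. f (\<phi> a))"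
    by (rule sum.reindex_bij_betw[symmetric])
  also have "\<dots> = - sum f A"
    using assms(3) by (simp add: sum_negf)
  finally show ?thesis by simp
qed

text \<open>The colour given by \<open>c\<close> makes the data behind the choice of a block
  invariant under the flip, so a second application selects the same block and undoes the first.
  \<open>P\<close> confines the flips to a region where membership in \<open>A\<close>
  survives.\<close>

lemma sum_flippable_tilings:
  fixes A :: "square set set set" and P :: "int \<Rightarrow> int \<Rightarrow> bool" and c :: int
  assumes "finite X" and tiling: "\<And>D. D \<in> A \<Longrightarrow> domino_tiling X D"
    and ex: "\<And>D. D \<in> A \<Longrightarrow> \<exists>x y. P x y \<and> even (x + y + c) \<and> fwd D x y \<and> bwd D (x + 1) (y + 1)"
    and closed: "\<And>D x y. D \<in> A \<Longrightarrow> P x y \<Longrightarrow> domino_tiling X (flip x y D) \<Longrightarrow> flip x y D \<in> A"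
  shows "(\<Sum>D\<in>A. \<i> ^ num_horizontal D) = 0"
proof -
  define Q where "Q = (\<lambda>D (x, y). P x y \<and> even (x + y + c) \<and> fwd D x y \<and> bwd D (x + 1) (y + 1))"
  define p where "p = (\<lambda>D. SOME s. Q D s)"
  define \<phi> where "\<phi> = (\<lambda>D. flip (fst (p D)) (snd (p D)) D)"
  have Qp: "Q D (p D)" if D: "D \<in> A" for D
  proof -
    obtain x y where "Q D (x, y)" using ex[OF D] unfolding Q_def by blast
    then show ?thesis unfolding p_def by (rule someI)
  qed
  have key: "\<phi> D \<in> A \<and> \<phi> (\<phi> D) = D \<and> \<i> ^ num_horizontal (\<phi> D) = - (\<i> ^ num_horizontal D)"
    if D: "D \<in> A" for D
  proof -
    obtain x y where xy: "p D = (x, y)" by fastforce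
    have q: "P x y" "even (x + y + c)" "fwd D x y" "bwd D (x + 1) (y + 1)"
      using Qp[OF D] by (simp_all add: Q_def xy)
    have \<phi>: "\<phi> D = flip x y D" by (simp add: \<phi>_def xy)
    note fl = tiling_flip[OF assms(1) tiling[OF D] q(3,4)]
    \<comment> \<open>Equality of the whole predicates matters: \<open>SOME\<close> then returns the
      same block for both tilings.\<close>
    have "Q (flip x y D) = Q D"
    proof (intro ext)
      fix s :: square
      obtain a b where s: "s = (a, b)" by fastforce
      show "Q (flip x y D) s = Q D s"
      proof (cases "even (a + b + c)")
        case True
        then have "even (a + b + x + y)" "even (a + 1 + (b + 1) + x + y)" using q(2) by presburger+
        then show ?thesis
          using fwd_flip[OF tiling[OF D] q(3,4)] bwd_flip[OF tiling[OF D] q(3,4)]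
          by (simp add: s Q_def)
      qed (simp add: s Q_def)
    qed
    then have "p (flip x y D) = p D" by (simp add: p_def)
    then show ?thesis using closed[OF D q(1) fl(1)] fl(2) by (simp add: \<phi>) (simp add: \<phi>_def xy)
  qed
  show ?thesis
    by (rule sum_sign_reversing_involution[where \<phi> = \<phi>]) (use key in auto)
qed

text \<open>The colour \<open>even (x + y + j)\<close> is that of \<open>(N, N - j)\<close>, the
  highest square of column \<open>N\<close> not matched across. If no block could be flipped,
  forward matches would propagate up the diagonals, and counting in two opposite corner triangles
  would contradict injectivity of the partner map.\<close>

lemma flippable_exists:
  fixes K N j :: int
  assumes D: "domino_tiling ({1..K} \<times> {1..N}) D" and NK: "N \<le> K" and j: "0 \<le> j" "j < N"
    and cross: "\<And>y. N - j < y \<Longrightarrow> y \<le> N \<Longrightarrow> {(N, y), (N + 1, y)} \<in> D"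
    and ncross: "{(N, N - j), (N + 1, N - j)} \<notin> D"
  shows "\<exists>x y. x < N \<and> even (x + y + j) \<and> fwd D x y \<and> bwd D (x + 1) (y + 1)"
proof (rule ccontr)
  let ?X = "{1..K} \<times> {1..N}"
  assume "\<not> ?thesis"
  then have nf: "\<not> bwd D (x + 1) (y + 1)" if "x < N" "even (x + y + j)" "fwd D x y" for x y
    using that by blast
  have sym: "{s, t} \<in> D \<Longrightarrow> {t, s} \<in> D" for s t by (simp add: insert_commute)
  have crossed: "t = (N + 1, y)" if "{(N, y), t} \<in> D" "N - j < y" "y \<le> N" for y t
    using tiling_unique_pair[OF D that(1) cross[OF that(2,3)]] .
  have crossed': "t = (N + 1, y)" if "{t, (N, y)} \<in> D" "N - j < y" "y \<le> N" for y t
    using crossed[OF sym[OF that(1)] that(2,3)] .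

  \<comment> \<open>The next square on the diagonal cannot be matched backwards, as that would give
    a block to flip, so it is matched forwards too.\<close>
  have fwd_diag: "fwd D (j + 1 - k + int t) (1 + k + int t)"
    if k: "0 \<le> k" "k \<le> j" "\<not> bwd D (j + 1 - k) (1 + k)" and t: "int t \<le> N - j - 1" for k t
    using t
  proof (induction t)
    case 0
    have "(j + 1 - k, 1 + k) \<in> ?X" using k j NK by auto
    then have "fwd D (j + 1 - k) (1 + k)" using fwd_or_bwd[OF D] k(3) by blast
    then show ?case by simp
  next
    case (Suc t)
    have IH: "fwd D (j + 1 - k + int t) (1 + k + int t)" using Suc by simp
    have "\<not> bwd D (j + 1 - k + int t + 1) (1 + k + int t + 1)"
      by (rule nf[OF _ _ IH]) (use Suc.prems k in auto)
    moreover have "(j + 1 - k + int t + 1, 1 + k + int t + 1) \<in> ?X"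
      using k j NK Suc.prems by auto
    ultimately have "fwd D (j + 1 - k + int t + 1) (1 + k + int t + 1)"
      using fwd_or_bwd[OF D] by blast
    then show ?case by (simp add: algebra_simps)
  qed
  have fwd_end: "fwd D (N - k) (N - j + k)"
    if "0 \<le> k" "k \<le> j" "\<not> bwd D (j + 1 - k) (1 + k)" for k
    using fwd_diag[OF that, of "nat (N - j - 1)"] j by (simp add: algebra_simps)

  define mate where "mate = (\<lambda>s. SOME t. {s, t} \<in> D)"
  have mate: "{s, mate s} \<in> D" if "s \<in> ?X" for s
    unfolding mate_def by (rule someI_ex) (use tiling_partner[OF D that] in blast)
  have mate_eq: "mate s = t" if "{s, t} \<in> D" for s t
    using tiling_unique_pair[OF D mate that] tiling_pair[OF D that] by blast
  have inj: "inj_on mate ?X"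
  proof (rule inj_onI)
    fix s t assume st: "s \<in> ?X" "t \<in> ?X" "mate s = mate t"
    have "{mate s, s} \<in> D" "{mate s, t} \<in> D"
      using sym[OF mate[OF st(1)]] sym[OF mate[OF st(2)]] st(3) by simp_all
    then show "s = t" by (rule tiling_unique_pair[OF D])
  qed

  txt \<open>Without a block to flip, each of the \<open>j + 1\<close> diagonals from \<open>(j + 1 - k, 1 + k)\<close> to
    \<open>(N - k, N - j + k)\<close> starts backwards or ends forwards, so one of its end squares, \<open>sel k\<close>, has
    its partner in the corner triangle \<open>B0\<close> or \<open>B1\<close>. Those also contain the partners of the squares
    of the other colour in the triangles, \<open>W0\<close> and \<open>W1\<close>, but have only \<open>j\<close> squares more than these.\<close>

  define sel where "sel = (\<lambda>k. if bwd D (j + 1 - k) (1 + k) then (j + 1 - k, 1 + k) else (N - k, N - j + k))"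
  define W0 W1 B0 B1 where
    "W0 = {(x, y) \<in> {1..j} \<times> {1..j}. x + y \<le> j \<and> even (x + y + j)}" and
    "W1 = {(x, y) \<in> {N - j..N - 1} \<times> {N - j..N}. x + y \<ge> 2 * N - j + 2 \<and> even (x + y + j)}" and
    "B0 = {(x, y) \<in> {1..j} \<times> {1..j}. x + y \<le> j + 1 \<and> odd (x + y + j)}" and
    "B1 = {(x, y) \<in> {N - j..N - 1} \<times> {N - j..N}. x + y \<ge> 2 * N - j + 1 \<and> odd (x + y + j)}"
  have fin: "finite W0" "finite W1" "finite B0" "finite B1"
    unfolding W0_def W1_def B0_def B1_def
    by (rule finite_subset[of _ "{1..j} \<times> {1..j}"] finite_subset[of _ "{N - j..N - 1} \<times> {N - j..N}"];
        auto)+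

  have m0: "mate s \<in> B0" if "s \<in> W0" for s
  proof -
    obtain x y where s: "s = (x, y)" by fastforce
    have *: "x \<ge> 1" "y \<ge> 1" "x + y \<le> j" "even (x + y + j)" using that by (auto simp: W0_def s)
    then have "s \<in> ?X" using j NK by (auto simp: s)
    from tiling_pair[OF D mate[OF this]] have "mate s \<in> ?X" "adjacent (x, y) (mate s)"
      by (simp_all add: s)
    then show ?thesis using * j by (auto simp: adjacent_iff B0_def)
  qed
  have m1: "mate s \<in> B1" if "s \<in> W1" for s
  proof -
    obtain x y where s: "s = (x, y)" by fastforce
    have *: "x \<le> N - 1" "y \<le> N" "x + y \<ge> 2 * N - j + 2" "even (x + y + j)"
      using that by (auto simp: W1_def s)
    then have sX: "s \<in> ?X" using j NK by (auto simp: s)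
    have "mate s \<in> ?X" "adjacent (x, y) (mate s)"
      using tiling_pair[OF D mate[OF sX]] by (simp_all add: s)
    \<comment> \<open>Squares of column \<open>N\<close> above row \<open>N - j\<close> are matched
      across, so partners of \<open>W1\<close> stay to the left of column \<open>N\<close>.\<close>
    moreover have "mate s \<noteq> (N, y)"
      using crossed'[of s y] mate[OF sX] * by (auto simp: s)
    ultimately show ?thesis using * j by (auto simp: adjacent_iff B1_def)
  qed
  have msel: "mate (sel k) \<in> B0 \<union> B1" and sel_X: "sel k \<in> ?X" if k: "k \<in> {0..j}" for k
  proof -
    have k': "0 \<le> k" "k \<le> j" using k by auto
    show "sel k \<in> ?X" using k' j NK by (auto simp: sel_def)
    show "mate (sel k) \<in> B0 \<union> B1"
    proof (cases "bwd D (j + 1 - k) (1 + k)")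
      case True
      then consider "{(j + 1 - k, 1 + k), (j + 1 - k - 1, 1 + k)} \<in> D"
        | "{(j + 1 - k, 1 + k), (j + 1 - k, 1 + k - 1)} \<in> D" unfolding bwd_def by blast
      then have "mate (sel k) \<in> B0"
      proof cases
        case 1
        show ?thesis
          using mate_eq[OF 1] tiling_pair(2)[OF D 1] True k' by (auto simp: sel_def B0_def)
      next
        case 2
        show ?thesis
          using mate_eq[OF 2] tiling_pair(2)[OF D 2] True k' by (auto simp: sel_def B0_def)
      qed
      then show ?thesis by blast
    next
      case False
      then consider "{(N - k, N - j + k), (N - k + 1, N - j + k)} \<in> D"
        | "{(N - k, N - j + k), (N - k, N - j + k + 1)} \<in> D"
        using fwd_end[OF k' False] unfolding fwd_def by blast
      then have "mate (sel k) \<in> B1"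
      proof cases
        case 1
        \<comment> \<open>\<open>k = 0\<close> would be the excluded crossing at
          \<open>(N, N - j)\<close>; \<open>k = 1\<close> would give the partner
          \<open>(N, N - j + 1)\<close>, which is matched across already.\<close>
        have "k \<noteq> 0" using 1 ncross by auto
        moreover have "k \<noteq> 1"
        proof
          assume "k = 1"
          then show False using crossed'[of "(N - 1, N - j + 1)" "N - j + 1"] 1 k' by auto
        qed
        ultimately show ?thesis
          using mate_eq[OF 1] tiling_pair(2)[OF D 1] False k' by (auto simp: sel_def B1_def)
      next
        case 2
        \<comment> \<open>The partner would be \<open>(N, N - j + 1)\<close>, which is matched
          across if \<open>j > 0\<close> and off the board if \<open>j = 0\<close>.\<close>
        have "k \<noteq> 0"
        proof
          assume k0: "k = 0"
          then have "{(N, N - j), (N, N - j + 1)} \<in> D" using 2 by simp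
          moreover from tiling_pair(2)[OF D this] have "j > 0" by simp
          ultimately show False using crossed'[of "(N, N - j)" "N - j + 1"] by auto
        qed
        then show ?thesis
          using mate_eq[OF 2] tiling_pair(2)[OF D 2] False k' by (auto simp: sel_def B1_def)
      qed
      then show ?thesis by blast
    qed
  qed

  have inj_sel: "inj_on sel {0..j}"
    by (rule inj_onI) (auto simp: sel_def split: if_splits)
  \<comment> \<open>Coordinate sums separate the sets: at most \<open>j\<close> on
    \<open>W0\<close>, \<open>j + 2\<close> or \<open>2 * N - j\<close> on the selected end squares,
    at least \<open>2 * N - j + 2\<close> on \<open>W1\<close>.\<close>
  have disj: "W0 \<inter> W1 = {}" "(W0 \<union> W1) \<inter> sel ` {0..j} = {}"
    using j by (auto simp: W0_def W1_def sel_def split: if_splits)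
  have "card (W0 \<union> W1 \<union> sel ` {0..j}) = card W0 + card W1 + nat (j + 1)"
    using fin disj card_image[OF inj_sel] j by (simp add: card_Un_disjoint)
  moreover have "card (W0 \<union> W1 \<union> sel ` {0..j}) \<le> card (B0 \<union> B1)"
  proof (rule card_inj_on_le)
    have "W0 \<subseteq> ?X" "W1 \<subseteq> ?X" using j NK by (auto simp: W0_def W1_def)
    then have "W0 \<union> W1 \<union> sel ` {0..j} \<subseteq> ?X" using sel_X by blast
    then show "inj_on mate (W0 \<union> W1 \<union> sel ` {0..j})" using inj inj_on_subset by blast
    show "mate ` (W0 \<union> W1 \<union> sel ` {0..j}) \<subseteq> B0 \<union> B1" using m0 m1 msel by blast
  qed (use fin in simp)
  moreover have "card (B0 \<union> B1) \<le> card W0 + card W1 + nat j"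
  proof -
    let ?u = "\<lambda>(x, y). (x, y + 1 :: int)" and ?d = "\<lambda>(x, y). (x, y - 1 :: int)"
    \<comment> \<open>After shifting \<open>B0\<close> down into \<open>W0\<close> and
      \<open>B1\<close> up into \<open>W1\<close>, only the bottom row of \<open>B0\<close> and the
      top row of \<open>B1\<close> remain. The former uses the \<open>t\<close> of the parity of
      \<open>j\<close>, the latter the others, so \<open>{1..j}\<close> indexes both
      together.\<close>
    let ?e = "\<lambda>t. if even (t + j) then (t, 1) else (N - t, N)"
    have "B0 \<union> B1 \<subseteq> ?u ` W0 \<union> ?d ` W1 \<union> ?e ` {1..j}"
    proof
      fix s assume s: "s \<in> B0 \<union> B1"
      obtain x y where xy: "s = (x, y)" by fastforce
      consider "s \<in> B0" "y = 1" | "s \<in> B0" "y > 1" | "s \<in> B1" "y = N" | "s \<in> B1" "y < N"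
        using s by (fastforce simp: xy B0_def B1_def)
      then show "s \<in> ?u ` W0 \<union> ?d ` W1 \<union> ?e ` {1..j}"
      proof cases
        case 1
        then have "s = ?e x" "x \<in> {1..j}" by (auto simp: xy B0_def)
        then show ?thesis by blast
      next
        case 2
        then have "s = ?u (x, y - 1)" "(x, y - 1) \<in> W0" by (auto simp: xy B0_def W0_def)
        then show ?thesis by blast
      next
        case 3
        then have "s = ?e (N - x)" "N - x \<in> {1..j}" by (auto simp: xy B1_def)
        then show ?thesis by blast
      next
        case 4
        then have "s = ?d (x, y + 1)" "(x, y + 1) \<in> W1" by (auto simp: xy B1_def W1_def)
        then show ?thesis by blast
      qed
    qed
    then have "card (B0 \<union> B1) \<le> card (?u ` W0 \<union> ?d ` W1 \<union> ?e ` {1..j})"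
      by (rule card_mono[rotated]) (use fin in simp)
    also have "\<dots> \<le> card (?u ` W0) + card (?d ` W1) + card (?e ` {1..j})"
      by (meson add_le_mono1 card_Un_le le_trans)
    also have "\<dots> \<le> card W0 + card W1 + card {1..j}"
      using fin by (intro add_mono card_image_le) auto
    finally show ?thesis by simp
  qed
  ultimately show False using j by linarith
qed

section \<open>Recurrences for rectangles\<close>

definition crossing :: "nat \<Rightarrow> square set set" where
  "crossing N = (\<lambda>y. {(int N, y), (int N + 1, y)}) ` {1..int N}"

text \<open>The block lies in columns up to \<open>a\<close>, so flips preserve the crossings from
  column \<open>a\<close> to \<open>a + 1\<close> that are already secured.\<close>

lemma domino_in_flip_iff:
  assumes "x < a"
  shows "{(a, b), (a + 1, b)} \<in> flip x y D \<longleftrightarrow> {(a, b), (a + 1, b)} \<in> D"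
  using assms
  by (auto simp: flip_def horizontal_pair_def vertical_pair_def doubleton_eq_iff)

text \<open>Crossings are forced one row at a time from the top: among tilings that cross in the top
  \<open>j\<close> rows, those that fail to cross in the next row cancel.\<close>

lemma tiling_sum_eq_sum_crossing:
  assumes "N \<le> K"
  shows "tiling_sum (rectangle K N)
       = (\<Sum>D | domino_tiling (rectangle K N) D \<and> crossing N \<subseteq> D. \<i> ^ num_horizontal D)"
proof -
  define E where "E = (\<lambda>j. {D. domino_tiling (rectangle K N) D \<and>
    (\<forall>y. int N - int j < y \<and> y \<le> int N \<longrightarrow> {(int N, y), (int N + 1, y)} \<in> D)})"
  let ?w = "\<lambda>D. \<i> ^ num_horizontal D"
  have fin: "finite (E j)" for j
    using finite_domino_tilings[OF finite_rectangle[of K N]]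
    by (rule finite_subset[rotated]) (auto simp: E_def domino_tilings_def)
  have "sum ?w (E j) = sum ?w (E 0)" if "j \<le> N" for j
    using that
  proof (induction j)
    case (Suc j)
    let ?d = "{(int N, int N - int j), (int N + 1, int N - int j)}"
    have split: "E (Suc j) = E j - {D \<in> E j. ?d \<notin> D}"
    proof -
      have "int N - int (Suc j) < y \<longleftrightarrow> int N - int j < y \<or> y = int N - int j" for y
        by auto
      then show ?thesis by (auto simp: E_def)
    qed
    have "sum ?w {D \<in> E j. ?d \<notin> D} = 0"
    proof (rule sum_flippable_tilings[where P = "\<lambda>x y. x < int N" and c = "int j"])
      fix D assume "D \<in> {D \<in> E j. ?d \<notin> D}"
      then show "\<exists>x y. x < int N \<and> even (x + y + int j) \<and> fwd D x y \<and> bwd D (x + 1) (y + 1)"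
        using assms Suc.prems
        by (intro flippable_exists[where K = "int K"]) (auto simp: E_def rectangle_def)
    next
      fix D x y
      assume "D \<in> {D \<in> E j. ?d \<notin> D}" "x < int N" "domino_tiling (rectangle K N) (flip x y D)"
      then show "flip x y D \<in> {D \<in> E j. ?d \<notin> D}"
        by (simp add: E_def domino_in_flip_iff)
    qed (auto simp: E_def finite_rectangle)
    then have "sum ?w (E (Suc j)) = sum ?w (E j)"
      unfolding split using fin by (subst sum_diff) auto
    then show ?case using Suc by simp
  qed simp
  from this[of N] have "sum ?w (E 0) = sum ?w (E N)" by simp
  moreover have "E 0 = domino_tilings (rectangle K N)"
    by (auto simp: E_def domino_tilings_def)
  moreover have "E N = {D. domino_tiling (rectangle K N) D \<and> crossing N \<subseteq> D}"
    by (auto simp: E_def crossing_def)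
  ultimately show ?thesis by (simp add: tiling_sum_def)
qed

lemma tiling_sum_empty [simp]: "tiling_sum {} = 1"
proof -
  have "domino_tilings {} = {{}}"
    by (auto simp: domino_tilings_def domino_tiling_def)
  then show ?thesis by (simp add: tiling_sum_def num_horizontal_def)
qed

lemma rectangle_0 [simp]: "rectangle 0 b = {}" "rectangle a 0 = {}"
  by (simp_all add: rectangle_def)

text \<open>There is no column \<open>N + 1\<close> to cross into, so the reduced sum is
  empty.\<close>

lemma tiling_sum_square:
  assumes "N > 0"
  shows "tiling_sum (rectangle N N) = 0"
proof -
  have "\<not> crossing N \<subseteq> D" if "domino_tiling (rectangle N N) D" for D
  proof
    assume "crossing N \<subseteq> D"
    then have "{(int N, 1), (int N + 1, 1)} \<in> D" using assms by (auto simp: crossing_def)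
    from tiling_pair(2)[OF that this] show False by (simp add: rectangle_def)
  qed
  then have "{D. domino_tiling (rectangle N N) D \<and> crossing N \<subseteq> D} = {}" by blast
  then show ?thesis
    using tiling_sum_eq_sum_crossing[of N N] by (simp only: sum.empty order_refl)
qed

lemma tiling_crossing: "domino_tiling ({int N, int N + 1} \<times> {1..int N}) (crossing N)"
proof (rule tilingI)
  fix d assume "d \<in> crossing N"
  then obtain y where "y \<in> {1..int N}" "d = {(int N, y), (int N + 1, y)}"
    by (auto simp: crossing_def)
  then show "\<exists>s\<in>{int N, int N + 1} \<times> {1..int N}. \<exists>t\<in>{int N, int N + 1} \<times> {1..int N}.
      adjacent s t \<and> d = {s, t}"
    by (intro bexI[of _ "(int N, y)"] bexI[of _ "(int N + 1, y)"]) (auto simp: adjacent_iff)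
qed (auto simp: crossing_def)

lemma num_horizontal_crossing: "num_horizontal (crossing N) = N"
proof -
  have "{d \<in> crossing N. horizontal d} = crossing N"
    by (auto simp: crossing_def horizontal_doubleton_iff)
  moreover have "inj_on (\<lambda>y. {(int N, y), (int N + 1, y)}) {1..int N}"
    by (auto simp: inj_on_def doubleton_eq_iff)
  ultimately show ?thesis
    by (simp add: num_horizontal_def crossing_def card_image)
qed

text \<open>The factor gained by adding \<open>N + 1\<close> columns to a rectangle of height \<open>N\<close>; for \<open>N = 0\<close>,
  where \<open>N - 1\<close> truncates, it is still correct, since \<open>rectangle 0 0\<close> has one tiling.\<close>

definition shift_factor :: "nat \<Rightarrow> complex" where
  "shift_factor N = \<i> ^ N * tiling_sum (rectangle (N - 1) N)"

text \<open>For \<open>N > 0\<close> the forced crossings fill columns \<open>N\<close> and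
  \<open>N + 1\<close> and separate \<open>N - 1\<close> columns on the left from \<open>M\<close>
  translated columns on the right.\<close>

lemma tiling_sum_shift:
  "tiling_sum (rectangle (M + N + 1) N) = shift_factor N * tiling_sum (rectangle M N)"
proof (cases "N = 0")
  case False
  let ?X = "rectangle (M + N + 1) N" and ?Y = "{int N, int N + 1} \<times> {1..int N}"
  let ?A = "rectangle (N - 1) N" and ?B = "(\<lambda>(x, y). (x + (int N + 1), y)) ` rectangle M N"
  have B: "?B = {int N + 2..int N + 1 + int M} \<times> {1..int N}"
  proof (intro equalityI subsetI)
    fix s assume "s \<in> {int N + 2..int N + 1 + int M} \<times> {1..int N}"
    then have "s = (\<lambda>(x, y). (x + (int N + 1), y)) (fst s - (int N + 1), snd s)"
      "(fst s - (int N + 1), snd s) \<in> rectangle M N"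
      by (auto simp: rectangle_def)
    then show "s \<in> ?B" by blast
  qed (auto simp: rectangle_def)
  have "tiling_sum ?X = \<i> ^ N * tiling_sum (?X - ?Y)"
  proof -
    have "?Y \<subseteq> ?X" using False by (auto simp: rectangle_def)
    from tiling_sum_containing[OF finite_rectangle this tiling_crossing]
    show ?thesis
      using tiling_sum_eq_sum_crossing[of N "M + N + 1"] by (simp add: num_horizontal_crossing)
  qed
  also have "?X - ?Y = ?A \<union> ?B"
    using False unfolding B by (auto simp: rectangle_def)
  also have "tiling_sum (?A \<union> ?B) = tiling_sum ?A * tiling_sum ?B"
  proof (rule tiling_sum_Un)
    show "\<not> adjacent s t" if "s \<in> ?A" "t \<in> ?B" for s t
      using that False unfolding B
      by (cases s) (auto simp: rectangle_def adjacent_iff)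
    show "?A \<inter> ?B = {}" using False unfolding B by (auto simp: rectangle_def)
  qed (simp_all add: finite_rectangle)
  finally show ?thesis by (simp add: shift_factor_def tiling_sum_translate)
qed (simp add: shift_factor_def)

section \<open>Closed forms of the shift factor\<close>

lemma shift_factor_0: "shift_factor 0 = 1"
  by (simp add: shift_factor_def)

text \<open>Adding columns to the empty board shows that \<open>shift_factor N\<close> is the sum
  for \<open>rectangle (Suc N) N\<close>, the transpose of the rectangle defining
  \<open>shift_factor (Suc N)\<close>.\<close>

lemma shift_factor_Suc:
  "shift_factor (Suc N) = \<i> ^ (Suc N + N * Suc N div 2) * cnj (shift_factor N)"
proof -
  have "shift_factor (Suc N) = \<i> ^ Suc N * tiling_sum (rectangle N (Suc N))"
    by (simp add: shift_factor_def)
  also have "tiling_sum (rectangle N (Suc N))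
      = \<i> ^ (N * Suc N div 2) * cnj (tiling_sum (rectangle (Suc N) N))"
    using tiling_sum_transpose[of N "Suc N"] by (simp add: mult.commute)
  also have "tiling_sum (rectangle (Suc N) N) = shift_factor N"
    using tiling_sum_shift[of 0 N] by simp
  finally show ?thesis by (simp add: power_add)
qed

lemma i_power_mult_cnj: "\<i> ^ n * cnj (\<i> ^ n) = 1"
  by (simp flip: power_mult_distrib)

text \<open>Two uses of \<open>shift_factor_Suc\<close> cancel the conjugations and leave a
  recurrence within each parity class.\<close>

lemma shift_factor_add_2: "shift_factor (N + 2) = \<i> ^ (N + 2) * shift_factor N"
proof -
  let ?e = "Suc N + N * Suc N div 2"
  have "Suc N * Suc (Suc N) div 2 = ?e" by simp
  then have "shift_factor (N + 2) = \<i> ^ (N + 2 + ?e) * cnj (\<i> ^ ?e * cnj (shift_factor N))"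
    using shift_factor_Suc[of "Suc N"] shift_factor_Suc[of N] by (simp only: add_2_eq_Suc')
  also have "\<dots> = \<i> ^ (N + 2) * (\<i> ^ ?e * cnj (\<i> ^ ?e)) * shift_factor N"
    by (simp only: power_add complex_cnj_mult complex_cnj_cnj mult_ac)
  finally show ?thesis by (simp only: i_power_mult_cnj mult_1_right)
qed

text \<open>The sign agrees with \<open>Jacobi_2\<close>, which ties added columns to the Jacobi
  symbol.\<close>

lemma shift_factor_even: "shift_factor (2 * k) = (-1) ^ (k * (k + 1) div 2)"
proof (induction k)
  case (Suc k)
  have "Suc k * (Suc k + 1) div 2 = (k + 1) + k * (k + 1) div 2"
    by (simp add: algebra_simps)
  moreover have "\<i> ^ (2 * k + 2) = (-1) ^ (k + 1)"
    using power_mult[of \<i> 2 "k + 1"] by simp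
  ultimately show ?case
    using Suc shift_factor_add_2[of "2 * k"] by (simp add: power_add)
qed (simp add: shift_factor_0)

lemma shift_factor_odd: "shift_factor (2 * k + 1) = \<i> ^ (k + 1)\<^sup>2"
proof (induction k)
  case 0
  then show ?case using shift_factor_Suc[of 0] by (simp add: shift_factor_0)
next
  case (Suc k)
  have "2 * k + 3 + (k + 1)\<^sup>2 = (Suc k + 1)\<^sup>2" by (simp add: power2_eq_square algebra_simps)
  moreover have "shift_factor (2 * Suc k + 1) = \<i> ^ (2 * k + 3) * \<i> ^ (k + 1)\<^sup>2"
    using Suc shift_factor_add_2[of "2 * k + 1"] by (simp add: numeral_3_eq_3)
  ultimately show ?case by (metis power_add)
qed

lemma tiling_sum_even_by_even_transpose:
  "tiling_sum (rectangle (2 * a) (2 * b)) = (-1) ^ (a * b) * cnj (tiling_sum (rectangle (2 * b) (2 * a)))"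
proof -
  have "2 * b * (2 * a) div 2 = 2 * (a * b)" by simp
  then show ?thesis
    using tiling_sum_transpose[of "2 * a" "2 * b"] by (simp add: power_mult)
qed

text \<open>Transpose, remove \<open>2 * k\<close> columns from a rectangle of height
  \<open>2 * k - 1\<close>, and transpose back. The sign is the one in
  \<open>Jacobi_add_2_mult\<close>.\<close>

lemma tiling_sum_odd_width_shift:
  assumes "k > 0"
  shows "tiling_sum (rectangle (2 * k - 1) (2 * r + 2 * k))
       = (-1) ^ (k * (k - 1) div 2) * tiling_sum (rectangle (2 * k - 1) (2 * r))"
proof -
  obtain l where k: "k = l + 1" using assms by (cases k) auto
  let ?w = "2 * l + 1" and ?b = "(2 * l + 1) * r"
  let ?T = "tiling_sum (rectangle ?w (2 * r))"
  have "tiling_sum (rectangle ?w (2 * r + 2 * k))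
      = \<i> ^ ((2 * r + 2 * k) * ?w div 2) * cnj (tiling_sum (rectangle (2 * r + 2 * k) ?w))"
    by (rule tiling_sum_transpose)
  also have "2 * r + 2 * k = 2 * r + ?w + 1" by (simp add: k)
  also have "tiling_sum (rectangle (2 * r + ?w + 1) ?w)
      = shift_factor ?w * tiling_sum (rectangle (2 * r) ?w)"
    by (rule tiling_sum_shift)
  also have "tiling_sum (rectangle (2 * r) ?w) = \<i> ^ ?b * cnj ?T"
  proof -
    have "?w * (2 * r) div 2 = ?b" by (simp add: mult.left_commute[of _ 2])
    then show ?thesis by (simp only: tiling_sum_transpose[of "2 * r" ?w])
  qed
  also have "shift_factor ?w = \<i> ^ (l + 1)\<^sup>2" by (rule shift_factor_odd)
  also have "(2 * r + ?w + 1) * ?w div 2 = ?b + ((l + 1)\<^sup>2 + l * (l + 1))"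
  proof -
    have "(2 * r + ?w + 1) * ?w = 2 * (?b + ((l + 1)\<^sup>2 + l * (l + 1)))"
      by (simp add: power2_eq_square algebra_simps)
    then show ?thesis by simp
  qed
  also have "\<i> ^ (?b + ((l + 1)\<^sup>2 + l * (l + 1))) * cnj (\<i> ^ (l + 1)\<^sup>2 * (\<i> ^ ?b * cnj ?T))
      = (\<i> ^ ?b * cnj (\<i> ^ ?b)) * (\<i> ^ (l + 1)\<^sup>2 * cnj (\<i> ^ (l + 1)\<^sup>2)) * \<i> ^ (l * (l + 1)) * ?T"
    by (simp only: power_add complex_cnj_mult complex_cnj_cnj mult_ac)
  \<comment> \<open>\<open>l * (l + 1)\<close> is even, so the surviving power of
    \<open>\<i>\<close> is a sign.\<close>
  also have "\<i> ^ (l * (l + 1)) = (-1) ^ (k * (k - 1) div 2)"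
  proof -
    have "\<i> ^ (2 * (l * (l + 1) div 2)) = (-1) ^ (l * (l + 1) div 2)"
      by (simp only: power_mult power2_i)
    moreover have "2 * (l * (l + 1) div 2) = l * (l + 1)" by simp
    ultimately show ?thesis by (simp add: k mult.commute)
  qed
  finally show ?thesis by (simp only: i_power_mult_cnj mult_1_left) (simp add: k)
qed

section \<open>The Jacobi symbol\<close>

lemma Legendre_values: "Legendre a p \<in> {-1, 0, 1}"
  by (simp add: Legendre_def)

lemma Legendre_cong:
  assumes "[a = b] (mod p)"
  shows "Legendre a p = Legendre b p"
proof -
  have "[x = a] (mod p) \<longleftrightarrow> [x = b] (mod p)" for x
    using assms by (simp add: cong_def)
  moreover have "[a = 0] (mod p) \<longleftrightarrow> [b = 0] (mod p)"
    using assms by (simp add: cong_def)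
  ultimately show ?thesis by (simp add: Legendre_def QuadRes_def)
qed

lemma Legendre_eq_0_iff: "Legendre a p = 0 \<longleftrightarrow> p dvd a"
  by (simp add: Legendre_def cong_0_iff)

text \<open>The two values differ by at most 2. This turns the congruences of Euler's criterion into
  equations.\<close>

lemma sign_cong_imp_eq:
  fixes u v p :: int
  assumes "[u = v] (mod p)" "p > 2" "u \<in> {-1, 0, 1}" "v \<in> {-1, 0, 1}"
  shows "u = v"
proof (rule ccontr)
  assume "u \<noteq> v"
  have "p dvd (u - v)" using assms(1) by (simp add: cong_iff_dvd_diff)
  then have "p \<le> \<bar>u - v\<bar>" using \<open>u \<noteq> v\<close> by (simp add: zdvd_imp_le)
  then show False using assms(2-4) by auto
qed

lemma Legendre_mult:
  fixes p :: nat
  assumes "prime p" "2 < p"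
  shows "Legendre (a * b) p = Legendre a p * Legendre b p"
proof (rule sign_cong_imp_eq)
  let ?e = "(p - 1) div 2"
  have "[Legendre (a * b) p = (a * b) ^ ?e] (mod p)"
    by (rule euler_criterion[OF assms])
  also have "(a * b) ^ ?e = a ^ ?e * b ^ ?e" by (rule power_mult_distrib)
  also have "[\<dots> = Legendre a p * Legendre b p] (mod p)"
    by (intro cong_mult cong_sym[OF euler_criterion[OF assms]])
  finally show "[Legendre (a * b) p = Legendre a p * Legendre b p] (mod p)" .
  show "Legendre a p * Legendre b p \<in> {-1, 0, 1}"
    using Legendre_values[of a p] Legendre_values[of b p] by auto
  show "int p > 2" using assms(2) by simp
qed (rule Legendre_values)

lemma Legendre_minus_1:
  fixes p :: nat
  assumes "prime p" "2 < p"
  shows "Legendre (-1) p = (-1) ^ ((p - 1) div 2)"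
  by (rule sign_cong_imp_eq[OF euler_criterion[OF assms]])
    (use assms Legendre_values[of "-1" p] in \<open>auto simp: minus_one_power_iff\<close>)

section \<open>Multiplicativity and periodicity of the Jacobi symbol\<close>

lemma Jacobi_1_right [simp]: "Jacobi a 1 = 1" "Jacobi a (Suc 0) = 1"
  by (simp_all add: Jacobi_def)

lemma Jacobi_prime: "prime p \<Longrightarrow> Jacobi a p = Legendre a p"
  by (simp add: Jacobi_def prime_factorization_prime)

lemma Jacobi_mult_right: "m > 0 \<Longrightarrow> n > 0 \<Longrightarrow> Jacobi a (m * n) = Jacobi a m * Jacobi a n"
  by (simp add: Jacobi_def prime_factorization_mult)

text \<open>Induction along the prime factorization, retaining oddness so that every prime exceeds 2
  and the Legendre laws apply.\<close>

lemma odd_nat_induct [consumes 1, case_names 1 mult]: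
  fixes n :: nat
  assumes "odd n" "P 1"
    and "\<And>p n. prime p \<Longrightarrow> 2 < p \<Longrightarrow> odd p \<Longrightarrow> odd n \<Longrightarrow> P n \<Longrightarrow> P (p * n)"
  shows "P n"
  using assms(1)
proof (induction n rule: prime_divisors_induct)
  case (factor p x)
  then have "odd p" "odd x" by auto
  moreover from \<open>odd p\<close> have "p \<noteq> 2" by auto
  moreover from this have "2 < p" using prime_ge_2_nat[of p] factor by simp
  ultimately show ?case using factor assms(3) by blast
qed (use assms(2) in auto)

lemma Jacobi_mult_left: "odd n \<Longrightarrow> Jacobi (a * b) n = Jacobi a n * Jacobi b n"
proof (induction n rule: odd_nat_induct)
  case (mult p n)
  then have "p > 0" "n > 0" by (auto intro: odd_pos)
  then show ?case
    using mult by (simp add: Jacobi_mult_right Jacobi_prime Legendre_mult)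
qed simp

lemma Jacobi_1_left [simp]: "odd n \<Longrightarrow> Jacobi 1 n = 1"
proof (induction n rule: odd_nat_induct)
  case (mult p n)
  have "QuadRes p 1" unfolding QuadRes_def by (intro exI[of _ 1]) simp
  moreover have "\<not> int p dvd 1" using mult by (simp add: zdvd1_eq)
  ultimately have "Legendre 1 p = 1" by (simp add: Legendre_def cong_0_iff)
  moreover have "p > 0" "n > 0" using mult by (auto intro: odd_pos)
  ultimately show ?case
    using mult by (simp add: Jacobi_mult_right Jacobi_prime)
qed simp

lemma Jacobi_power_left: "odd n \<Longrightarrow> Jacobi (a ^ e) n = Jacobi a n ^ e"
  by (induction e) (simp_all add: Jacobi_mult_left)

lemma Jacobi_cong:
  assumes "[a = b] (mod int n)"
  shows "Jacobi a n = Jacobi b n"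
  unfolding Jacobi_def
proof (intro arg_cong[where f = prod_mset] image_mset_cong Legendre_cong)
  fix p assume "p \<in># prime_factorization n"
  then have "int p dvd int n" using in_prime_factors_imp_dvd by fastforce
  then show "[a = b] (mod int p)" using assms cong_dvd_modulus by blast
qed

lemma Jacobi_eq_0:
  assumes "prime p" "int p dvd a" "p dvd n" "n > 0"
  shows "Jacobi a n = 0"
proof -
  have "p \<in># prime_factorization n"
    using assms by (simp add: in_prime_factors_iff)
  moreover have "Legendre a p = 0" using assms(2) by (simp add: Legendre_eq_0_iff)
  ultimately show ?thesis unfolding Jacobi_def by (force simp: prod_mset_zero_iff)
qed

lemma Jacobi_self: "n > 1 \<Longrightarrow> Jacobi (int n) n = 0"
  using Jacobi_eq_0[of _ "int n" n] prime_factor_nat[of n] by fastforce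

section \<open>Reciprocity and the supplementary laws\<close>

lemma minus_one_power_half_mult:
  assumes "odd m" "odd n"
  shows "(-1 :: int) ^ ((m * n - 1) div 2 * c)
       = (-1) ^ ((m - 1) div 2 * c) * (-1) ^ ((n - 1) div 2 * c)"
proof -
  obtain a b where ab: "m = 2 * a + 1" "n = 2 * b + 1" using assms by (metis oddE)
  \<comment> \<open>Modulo 2 the half of a product is the sum of the halves, which makes the signs
    in the laws below multiplicative.\<close>
  have "(m * n - 1) div 2 = 2 * (a * b) + a + b"
    unfolding ab by (simp add: algebra_simps)
  then have "(m * n - 1) div 2 * c = 2 * (a * b * c) + a * c + b * c"
    by (simp add: algebra_simps)
  then show ?thesis by (simp add: ab power_add)
qed

lemma Jacobi_minus_1: "odd n \<Longrightarrow> Jacobi (-1) n = (-1) ^ ((n - 1) div 2)"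
proof (induction n rule: odd_nat_induct)
  case (mult p n)
  then have "p > 0" "n > 0" by (auto intro: odd_pos)
  then show ?case
    using mult minus_one_power_half_mult[of p n 1]
    by (simp add: Jacobi_mult_right Jacobi_prime Legendre_minus_1)
qed simp

text \<open>For distinct primes \<open>Legendre q p\<close> is its own inverse, which solves the
  product form of quadratic reciprocity for the other symbol; for equal primes both symbols are
  0.\<close>

lemma Legendre_reciprocity:
  fixes p q :: nat
  assumes "prime p" "2 < p" "prime q" "2 < q"
  shows "Legendre p q = (-1) ^ ((p - 1) div 2 * ((q - 1) div 2)) * Legendre q p"
proof (cases "p = q")
  case True
  then show ?thesis using Legendre_eq_0_iff[of "int p" "int p"] by simp
next
  case False
  then have "\<not> int p dvd int q" using primes_dvd_imp_eq[OF assms(1,3)] by auto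
  then have "Legendre q p = 1 \<or> Legendre q p = -1"
    using Legendre_values[of q p] by (auto simp: Legendre_eq_0_iff)
  then show ?thesis using Quadratic_Reciprocity[OF assms False] by auto
qed

text \<open>Symbols and sign are multiplicative in each argument, so two nested inductions over
  prime factors reduce to the Legendre law. Common prime factors fall under its case of equal
  primes.\<close>

theorem Jacobi_reciprocity:
  assumes "odd m" "odd n"
  shows "Jacobi (int m) n = (-1) ^ ((m - 1) div 2 * ((n - 1) div 2)) * Jacobi (int n) m"
  using assms
proof (induction m rule: odd_nat_induct)
  case (mult p m)
  have p: "Jacobi (int p) n = (-1) ^ ((p - 1) div 2 * ((n - 1) div 2)) * Jacobi (int n) p"
    using \<open>odd n\<close>
  proof (induction n rule: odd_nat_induct)
    case 1
    have "Jacobi 1 p = 1" using mult.hyps by simp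
    then show ?case by simp
  next
    case (mult q n)
    have pos: "q > 0" "n > 0" using mult by (auto intro: odd_pos)
    let ?s = "\<lambda>r. (-1 :: int) ^ ((p - 1) div 2 * ((r - 1) div 2))"
    have "Jacobi (int p) (q * n) = Jacobi (int p) q * Jacobi (int p) n"
      by (rule Jacobi_mult_right[OF pos])
    also have "Jacobi (int p) q = ?s q * Jacobi (int q) p"
      using Legendre_reciprocity[of p q] mult.hyps \<open>prime p\<close> \<open>2 < p\<close>
      by (simp add: Jacobi_prime)
    also note mult.IH
    also have "?s q * Jacobi (int q) p * (?s n * Jacobi (int n) p)
        = (?s q * ?s n) * Jacobi (int q * int n) p"
      using \<open>odd p\<close> by (simp add: Jacobi_mult_left)
    also have "?s q * ?s n = ?s (q * n)"
      using minus_one_power_half_mult[of q n "(p - 1) div 2"] mult.hyps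
      by (simp add: mult.commute)
    finally show ?case by simp
  qed
  have "p > 0" "m > 0" using mult by (auto intro: odd_pos)
  let ?s = "\<lambda>r. (-1 :: int) ^ ((r - 1) div 2 * ((n - 1) div 2))"
  have "Jacobi (int (p * m)) n = Jacobi (int p) n * Jacobi (int m) n"
    using \<open>odd n\<close> by (simp add: Jacobi_mult_left)
  also have "\<dots> = (?s p * ?s m) * (Jacobi (int n) p * Jacobi (int n) m)"
    using p mult.IH \<open>odd n\<close> by simp
  also have "Jacobi (int n) p * Jacobi (int n) m = Jacobi (int n) (p * m)"
    by (rule Jacobi_mult_right[symmetric]) fact+
  also have "?s p * ?s m = ?s (p * m)"
    using minus_one_power_half_mult[of p m "(n - 1) div 2"] mult.hyps by simp
  finally show ?case .
qed simp

text \<open>Descent from \<open>n = 2 * k + 3\<close> to \<open>n - 2\<close>: modulo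
  \<open>n\<close> the number \<open>n - 2\<close> is -2, and modulo \<open>n - 2\<close> the number
  \<open>n\<close> is 2. The reciprocity step in between has trivial sign, as
  \<open>k * (k + 1)\<close> is even.\<close>

lemma Jacobi_2: "Jacobi 2 (2 * k + 1) = (-1) ^ (k * (k + 1) div 2)"
proof (induction k)
  case (Suc k)
  let ?n = "2 * Suc k + 1" and ?n' = "2 * k + 1"
  have "Jacobi 2 ?n = Jacobi (-1) ?n * Jacobi (-2) ?n"
    using Jacobi_mult_left[of ?n "-1" "-2"] by simp
  also have "Jacobi (-1) ?n = (-1) ^ (k + 1)"
    by (subst Jacobi_minus_1) simp_all
  also have "Jacobi (-2) ?n = Jacobi (int ?n') ?n"
    by (rule Jacobi_cong[OF cong_sym]) (simp add: cong_iff_dvd_diff)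
  also have "\<dots> = (-1) ^ (k * (k + 1)) * Jacobi (int ?n) ?n'"
    by (subst Jacobi_reciprocity) simp_all
  also have "Jacobi (int ?n) ?n' = Jacobi 2 ?n'"
    by (rule Jacobi_cong) (simp add: cong_iff_dvd_diff)
  also have "(-1 :: int) ^ (k * (k + 1)) = 1" by simp
  finally have "Jacobi 2 ?n = (-1) ^ ((k + 1) + k * (k + 1) div 2)"
    using Suc.IH by (simp add: power_add)
  also have "(k + 1) + k * (k + 1) div 2 = Suc k * (Suc k + 1) div 2"
    by (simp add: algebra_simps)
  finally show ?case .
qed simp

section \<open>Dependence of the symbol on its modulus\<close>

lemma Jacobi_add_4_mult:
  assumes "odd k" "odd n"
  shows "Jacobi (int k) (n + 4 * k * t) = Jacobi (int k) n"
proof -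
  obtain a b where ab: "k = 2 * a + 1" "n = 2 * b + 1" using assms by (metis oddE)
  \<comment> \<open>The half changes by an even number, so both uses of reciprocity carry the same
    sign and only \<open>n\<close> modulo \<open>k\<close> counts.\<close>
  have "(n + 4 * k * t - 1) div 2 = b + 2 * (k * t)" by (simp add: ab(2))
  then have "Jacobi (int k) (n + 4 * k * t) = (-1) ^ (a * (b + 2 * (k * t))) * Jacobi (int (n + 4 * k * t)) k"
    using assms by (subst Jacobi_reciprocity) (simp_all add: ab(1))
  also have "Jacobi (int (n + 4 * k * t)) k = Jacobi (int n) k"
    by (rule Jacobi_cong) (simp add: cong_iff_dvd_diff)
  also have "a * (b + 2 * (k * t)) = a * b + 2 * (a * (k * t))"
    by (simp add: distrib_left mult.left_commute)
  also have "(-1 :: int) ^ (a * b + 2 * (a * (k * t))) = (-1) ^ (a * b)"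
    by (simp add: power_add)
  also have "(-1) ^ (a * b) * Jacobi (int n) k = Jacobi (int k) n"
    using assms by (subst (2) Jacobi_reciprocity) (simp_all add: ab)
  finally show ?thesis .
qed

lemma Jacobi_2_add_4:
  assumes "odd n"
  shows "Jacobi 2 (n + 4 * t) = (-1) ^ t * Jacobi 2 n"
proof -
  obtain b where b: "n = 2 * b + 1" using assms by (metis oddE)
  have half: "(x + 2 * c) div 2 = x div 2 + c" for x c :: nat by simp
  have "(b + 2 * t) * (b + 2 * t + 1) = b * (b + 1) + 2 * (t + 2 * (t * b + t * t))"
    by (simp add: algebra_simps)
  then have "(b + 2 * t) * (b + 2 * t + 1) div 2 = b * (b + 1) div 2 + (t + 2 * (t * b + t * t))"
    by (simp only: half)
  moreover have "n + 4 * t = 2 * (b + 2 * t) + 1" by (simp add: b)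
  ultimately show ?thesis
    using Jacobi_2[of "b + 2 * t"] Jacobi_2[of b] by (simp add: b power_add)
qed

text \<open>Counterpart of \<open>tiling_sum_odd_width_shift\<close>. For odd \<open>k\<close> it is
  reciprocity. For even \<open>k\<close> with odd part \<open>q\<close>, the shift
  \<open>2 * k\<close> is a multiple of \<open>4 * q\<close>, so \<open>q\<close> contributes no
  change and each factor 2 contributes a sign.\<close>

lemma Jacobi_add_2_mult:
  assumes "odd n" "k > 0"
  shows "Jacobi (int k) (n + 2 * k) = (-1) ^ (k * (k - 1) div 2) * Jacobi (int k) n"
proof (cases "odd k")
  case True
  obtain a b where ab: "k = 2 * a + 1" "n = 2 * b + 1" using assms True by (metis oddE)
  have "(n + 2 * k - 1) div 2 = b + k" by (simp add: ab(2))
  then have "Jacobi (int k) (n + 2 * k) = (-1) ^ (a * (b + k)) * Jacobi (int (n + 2 * k)) k"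
    using assms True by (subst Jacobi_reciprocity) (simp_all add: ab(1))
  also have "Jacobi (int (n + 2 * k)) k = Jacobi (int n) k"
    by (rule Jacobi_cong) (simp add: cong_iff_dvd_diff)
  also have "\<dots> = (-1) ^ (a * b) * Jacobi (int k) n"
    using assms True by (subst Jacobi_reciprocity) (simp_all add: ab mult.commute)
  finally have "Jacobi (int k) (n + 2 * k) = (-1) ^ (a * k) * Jacobi (int k) n"
    by (simp add: distrib_left minus_one_power_iff)
  moreover have "k * (k - 1) div 2 = a * k" by (simp add: ab(1))
  ultimately show ?thesis by simp
next
  case False
  define e where "e = multiplicity 2 k"
  obtain q where eq: "k = 2 ^ e * q" "odd q"
    unfolding e_def by (rule multiplicity_decompose'[of k 2]) (use assms(2) in auto)
  with False obtain e' where e': "e = Suc e'" by (cases e) auto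
  have k: "k = 2 * (2 ^ e' * q)" "2 * k = 4 * (2 ^ e' * q)" by (simp_all add: eq(1) e')
  have J: "Jacobi (int k) r = Jacobi 2 r ^ e * Jacobi (int q) r" if "odd r" for r
    using that by (simp add: eq(1) Jacobi_mult_left Jacobi_power_left)
  have "Jacobi (int k) (n + 2 * k) = Jacobi 2 (n + 2 * k) ^ e * Jacobi (int q) (n + 2 * k)"
    using assms(1) by (intro J) simp
  also have "Jacobi (int q) (n + 2 * k) = Jacobi (int q) n"
    using Jacobi_add_4_mult[OF eq(2) assms(1), of "2 ^ e'"] by (simp add: k mult_ac)
  also have "Jacobi 2 (n + 2 * k) = (-1) ^ (2 ^ e' * q) * Jacobi 2 n"
    unfolding k(2) by (rule Jacobi_2_add_4[OF assms(1)])
  also have "((-1) ^ (2 ^ e' * q) * Jacobi 2 n) ^ e * Jacobi (int q) n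
      = ((-1) ^ (2 ^ e' * q)) ^ e * Jacobi (int k) n"
    using J[OF assms(1)] by (simp add: power_mult_distrib)
  \<comment> \<open>For \<open>e' = 0\<close> the total exponents on both sides are odd; otherwise
    both are even.\<close>
  also have "((-1 :: int) ^ (2 ^ e' * q)) ^ e = (-1) ^ (2 ^ e' * q * (k - 1))"
    using eq(2) assms(2) by (cases "e' = 0") (simp_all add: e' k(1) minus_one_power_iff)
  also have "2 ^ e' * q * (k - 1) = k * (k - 1) div 2"
    by (simp add: k(1))
  finally show ?thesis .
qed

section \<open>The Euclidean algorithm\<close>

definition jac :: "nat \<Rightarrow> nat \<Rightarrow> int" where
  "jac m n = (if odd m then Jacobi (int m) n else Jacobi (int (m div 2)) n)"

text \<open>Adding the odd \<open>n\<close> switches the branch of \<open>jac\<close>. The halving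
  gained or lost costs \<open>Jacobi 2 n\<close>, which is its own inverse.\<close>

lemma jac_add_self:
  assumes "odd n"
  shows "jac (m + n) n = Jacobi 2 n * jac m n"
proof -
  have half: "Jacobi (int l) n = Jacobi 2 n * Jacobi (int (l div 2)) n" if "even l" for l
    using that Jacobi_mult_left[OF assms, of 2 "int (l div 2)"] by auto
  have eq: "Jacobi (int (m + n)) n = Jacobi (int m) n"
    by (rule Jacobi_cong) (simp add: cong_def)
  have "Jacobi 2 n * Jacobi 2 n = 1"
  proof -
    obtain k where "n = 2 * k + 1" using assms by (metis oddE)
    then show ?thesis using Jacobi_2[of k] by (simp flip: power_mult_distrib)
  qed
  then have cancel: "Jacobi 2 n * (Jacobi 2 n * x) = x" for x
    by (simp flip: mult.assoc)
  show ?thesis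
  proof (cases "odd m")
    case True
    then have "Jacobi (int m) n = Jacobi 2 n * Jacobi (int ((m + n) div 2)) n"
      using half[of "m + n"] eq assms by simp
    then show ?thesis using True assms cancel by (simp add: jac_def)
  next
    case False
    then show ?thesis using half[of m] eq assms by (simp add: jac_def)
  qed
qed

lemma tiling_sum_eq_jac_add:
  assumes "odd n" "m > 0" "tiling_sum (rectangle (m - 1) (n - 1)) = of_int (jac m n)"
  shows "tiling_sum (rectangle (m + n - 1) (n - 1)) = of_int (jac (m + n) n)"
proof -
  obtain b where b: "n = 2 * b + 1" using assms(1) by (metis oddE)
  have "m + n - 1 = (m - 1) + (n - 1) + 1" using assms(2) b by simp
  then have "tiling_sum (rectangle (m + n - 1) (n - 1)) = shift_factor (n - 1) * of_int (jac m n)"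
    by (simp only: tiling_sum_shift assms(3))
  \<comment> \<open>Both closed forms have the exponent \<open>b * (b + 1) div 2\<close>.\<close>
  also have "shift_factor (n - 1) = of_int (Jacobi 2 n)"
    using shift_factor_even[of b] Jacobi_2[of b] by (simp add: b)
  finally show ?thesis by (simp add: jac_add_self[OF assms(1)])
qed

text \<open>Euclidean descent: \<open>m > n\<close> removes \<open>n\<close> columns, even
  \<open>m < n\<close> removes \<open>m\<close> rows, and odd \<open>m < n\<close> exchanges the
  roles by transposition and reciprocity.\<close>

lemma tiling_sum_eq_jac:
  assumes "m > 0" "odd n"
  shows "tiling_sum (rectangle (m - 1) (n - 1)) = of_int (jac m n)"
  using assms
proof (induction "m + n" arbitrary: m n rule: less_induct)
  case less
  have n: "n > 0" using less.prems by (auto intro: odd_pos)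
  consider "m > n" | "m = n" | "m < n" "even m" | "m < n" "odd m" by linarith
  then show ?case
  proof cases
    case 1
    have "tiling_sum (rectangle (m - n - 1) (n - 1)) = of_int (jac (m - n) n)"
      using 1 less.prems n by (intro less.hyps) auto
    then show ?thesis using tiling_sum_eq_jac_add[of n "m - n"] 1 less.prems by simp
  next
    case 2
    show ?thesis
    proof (cases "n = 1")
      case False
      then have "n > 1" using n by simp
      then show ?thesis
        using 2 less.prems tiling_sum_square[of "n - 1"] Jacobi_self[of n] by (simp add: jac_def)
    qed (use 2 in \<open>simp add: jac_def\<close>)
  next
    case 3
    then obtain k where k: "m = 2 * k" by auto
    have "odd (n - m)" using 3 less.prems by simp
    then obtain r where r: "n - m = 2 * r + 1" by (metis oddE)
    have n': "n = 2 * r + 1 + 2 * k" using r k 3 by simp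
    have "k > 0" using less.prems k by simp
    have IH: "tiling_sum (rectangle (m - 1) (2 * r)) = of_int (jac m (2 * r + 1))"
      using less.hyps[of m "2 * r + 1"] less.prems n' \<open>k > 0\<close> by simp
    have "tiling_sum (rectangle (m - 1) (n - 1))
        = (-1) ^ (k * (k - 1) div 2) * of_int (jac m (2 * r + 1))"
      using tiling_sum_odd_width_shift[OF \<open>k > 0\<close>, of r] IH by (simp add: k n')
    also have "\<dots> = of_int (jac m n)"
      using Jacobi_add_2_mult[of "2 * r + 1" k] \<open>k > 0\<close> by (simp add: jac_def k n')
    finally show ?thesis .
  next
    case 4
    obtain a where a: "m = 2 * a + 1" using 4 by (metis oddE)
    obtain b where b: "n = 2 * b + 1" using less.prems by (metis oddE)
    \<comment> \<open>Transposition alone keeps \<open>m + n\<close> fixed, so the induction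
      hypothesis is used at \<open>(n - m, m)\<close> and \<open>m\<close> columns are added to the
      transposed board.\<close>
    have "tiling_sum (rectangle (n - m - 1) (m - 1)) = of_int (jac (n - m) m)"
      using 4 less.prems by (intro less.hyps) auto
    then have *: "tiling_sum (rectangle (n - 1) (m - 1)) = of_int (jac n m)"
      using tiling_sum_eq_jac_add[of m "n - m"] 4 by simp
    have "tiling_sum (rectangle (m - 1) (n - 1)) = (-1) ^ (a * b) * of_int (jac n m)"
      using tiling_sum_even_by_even_transpose[of a b] * by (simp add: a b)
    also have "\<dots> = of_int (jac m n)"
      using Jacobi_reciprocity[of m n] 4 less.prems by (simp add: jac_def a b)
    finally show ?thesis .
  qed
qed

theorem theorem1p1:
  fixes m n :: nat
  assumes "m > 0" and "n > 0" and "odd n"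
  shows "(\<Sum>D\<in>domino_tilings (rectangle (m - 1) (n - 1)). \<i> ^ num_horizontal D) =
    (if odd m then of_int (Jacobi (int m) n) else of_int (Jacobi (int (m div 2)) n))"
  using tiling_sum_eq_jac[OF assms(1,3)] by (simp add: tiling_sum_def jac_def)

end
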